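(* Let $a\in\mathbb R$ and let $f\in D_{a,\infty}([0,\infty),\mathbb R)$ with $f(0)>a$. Then the left fast-forwarding map $\mathrm N^l_a:D_{a,\infty}([0,\infty),\mathbb R)\to D([0,\infty),\mathbb R)$ is continuous at $f$ if and only if $f$ satisfies both of the following conditions: (1) if there exist $\epsilon>0$ and $t_1<t_2<t_3<t_4$ such that $f(t)\ge a+\epsilon$ for all $t\in[t_1,t_2)\cup[t_3,t_4)$ and $f(t)\le a$ for all $t\in[t_2,t_3)$, then $\sup\{f(t):t\in[t_2,t_3)\}<a$; (2) $\lambda\big(t\in[0,\infty):f(t)=a\big)=0$.
   Context: $\lambda$ is Lebesgue measure. $D([0,\infty),\mathbb R)$ is the space of real càdlàg functions on $[0,\infty)$ with the Skorokhod $J_1$ topology. For $-\infty\le a<b\le\infty$, $D_{a,b}([0,\infty),\mathbb R)$ is the subspace of those $f\in D([0,\infty),\mathbb R)$ with $\lambda(t\in[0,\infty):f(t)\in(a,b))=\infty$, with the subspace topology. The left fast-forwarding map at $a$ is $\mathrm N^l_a(f)=f(A_f^{-1})$, where $A_f(t)=\int_0^t\mathbf 1_{\{f(z)>a\}}\,dz$ and $A_f^{-1}(t)=\inf\{s>0:A_f(s)>t\}$. *)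

theory Defs
  imports "HOL-Analysis.Analysis"
begin

text \<open>
  Elements of \<open>D([0,\<infinity>), \<real>)\<close> are represented by functions on all reals whose value at negative
  arguments is the fixed dummy value prescribed by \<^const>\<open>extensional\<close>, so that equality of
  representatives is equality of functions on \<open>[0,\<infinity>)\<close>.
\<close>

definition cadlag_space :: "(real \<Rightarrow> real) set" where
  "cadlag_space = {f \<in> extensional {0..}.
     (\<forall>t\<ge>0. (f \<longlongrightarrow> f t) (at_right t)) \<and> (\<forall>t>0. \<exists>l. (f \<longlongrightarrow> l) (at_left t))}"

definition time_changes :: "(real \<Rightarrow> real) set" where
  "time_changes = {l. strict_mono_on {0..} l \<and> continuous_on {0..} l \<and> l ` {0..} = {0..}}"

text \<open>
  The Skorokhod \<open>J\<^sub>1\<close> topology: a neighbourhood base at \<open>f\<close> is formed by the sets of those \<open>g\<close> that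
  are \<open>e\<close>-close to \<open>f\<close> on \<open>[0,T]\<close> after a time change \<open>e\<close>-close to the identity.  Lemma
  \<open>limitin_J1_topology\<close> below shows that the convergent sequences are the usual ones (Jacod and
  Shiryaev, Limit Theorems for Stochastic Processes, Theorem VI.1.14); since \<open>T\<close> and \<open>1/e\<close> may be
  restricted to naturals, the topology is first countable and hence determined by them.
\<close>

definition J1_nhd :: "(real \<Rightarrow> real) \<Rightarrow> real \<Rightarrow> real \<Rightarrow> (real \<Rightarrow> real) set" where
  "J1_nhd f T e = {g \<in> cadlag_space. \<exists>l\<in>time_changes.
     (\<forall>s\<ge>0. \<bar>l s - s\<bar> < e) \<and> (\<forall>s\<in>{0..T}. \<bar>g (l s) - f s\<bar> < e)}"

definition J1_topology :: "(real \<Rightarrow> real) topology" where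
  "J1_topology = topology (\<lambda>U. U \<subseteq> cadlag_space \<and>
     (\<forall>f\<in>U. \<exists>T>0. \<exists>e>0. J1_nhd f T e \<subseteq> U))"

text \<open>
  Cadlag functions are Borel measurable on \<open>[0,\<infinity>)\<close>, so \<open>lborel\<close> measures all the sets below.
  The infimum in \<open>time_above_inv a f t\<close> is over a nonempty set for all \<open>t \<ge> 0\<close> as soon as
  \<open>f \<in> cadlag_between a \<infinity>\<close>, so it is the true one.
\<close>

definition cadlag_between :: "ereal \<Rightarrow> ereal \<Rightarrow> (real \<Rightarrow> real) set" where
  "cadlag_between a b = {f \<in> cadlag_space.
     emeasure lborel {t \<in> {0..}. a < ereal (f t) \<and> ereal (f t) < b} = \<infinity>}"

definition time_above :: "real \<Rightarrow> (real \<Rightarrow> real) \<Rightarrow> real \<Rightarrow> real" where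
  "time_above a f t = (LINT z:{0..t}|lborel. indicator {z. f z > a} z)"

definition time_above_inv :: "real \<Rightarrow> (real \<Rightarrow> real) \<Rightarrow> real \<Rightarrow> real" where
  "time_above_inv a f t = Inf {s. s > 0 \<and> time_above a f s > t}"

definition left_fast_forward :: "real \<Rightarrow> (real \<Rightarrow> real) \<Rightarrow> (real \<Rightarrow> real)" where
  "left_fast_forward a f = restrict (\<lambda>t. f (time_above_inv a f t)) {0..}"


lemma J1_nhd_mono: "T' \<ge> T \<Longrightarrow> e' \<le> e \<Longrightarrow> J1_nhd f T' e' \<subseteq> J1_nhd f T e"
  unfolding J1_nhd_def
proof (rule subsetI, unfold mem_Collect_eq, elim bexE conjE)
  fix g l
  assume "T \<le> T'" "e' \<le> e" and l: "g \<in> cadlag_space" "l \<in> time_changes"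
    "\<forall>s\<ge>0. \<bar>l s - s\<bar> < e'" "\<forall>s\<in>{0..T'}. \<bar>g (l s) - f s\<bar> < e'"
  then show "g \<in> cadlag_space \<and> (\<exists>l\<in>time_changes.
      (\<forall>s\<ge>0. \<bar>l s - s\<bar> < e) \<and> (\<forall>s\<in>{0..T}. \<bar>g (l s) - f s\<bar> < e))"
    by (intro conjI bexI[OF _ l(2)]) (auto intro: less_le_trans[OF _ \<open>e' \<le> e\<close>])
qed

lemma id_time_changes: "(\<lambda>s. s) \<in> time_changes"
  unfolding time_changes_def by (auto simp: strict_mono_on_def)

lemma time_changes_comp:
  assumes l: "l \<in> time_changes" and m: "m \<in> time_changes"
  shows "(\<lambda>s. m (l s)) \<in> time_changes"
proof -
  have lc: "continuous_on {0..} l" and li: "l ` {0..} = {0..}" and ls: "strict_mono_on {0..} l"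
    using l by (auto simp: time_changes_def)
  have mc: "continuous_on {0..} m" and mi: "m ` {0..} = {0..}" and ms: "strict_mono_on {0..} m"
    using m by (auto simp: time_changes_def)
  have "continuous_on {0..} (m \<circ> l)"
    using lc mc li by (intro continuous_on_compose) auto
  moreover have "(m \<circ> l) ` {0..} = {0..}"
    using li mi by (simp only: image_comp[symmetric])
  moreover have "strict_mono_on {0..} (m \<circ> l)"
  proof (intro strict_mono_onI)
    fix r s :: real assume rs: "r \<in> {0..}" "s \<in> {0..}" "r < s"
    then have "l r \<in> {0..}" "l s \<in> {0..}" "l r < l s"
      using li strict_mono_onD[OF ls] by blast+
    then show "(m \<circ> l) r < (m \<circ> l) s"
      using strict_mono_onD[OF ms] by simp
  qed
  ultimately show ?thesis
    by (simp add: time_changes_def o_def)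
qed

lemma J1_nhd_self:
  assumes "f \<in> cadlag_space" "e > 0" shows "f \<in> J1_nhd f T e"
  unfolding J1_nhd_def mem_Collect_eq
  using assms by (intro conjI bexI[OF _ id_time_changes]) simp_all

lemma J1_nhd_trans:
  assumes g: "g \<in> J1_nhd f T e1" and h: "h \<in> J1_nhd g (T + e1) e2"
  shows "h \<in> J1_nhd f T (e1 + e2)"
proof -
  obtain l where l: "l \<in> time_changes" "\<And>s. s \<ge> 0 \<Longrightarrow> \<bar>l s - s\<bar> < e1"
      "\<And>s. s \<in> {0..T} \<Longrightarrow> \<bar>g (l s) - f s\<bar> < e1"
    using g unfolding J1_nhd_def by auto
  obtain m where m: "m \<in> time_changes" "\<And>s. s \<ge> 0 \<Longrightarrow> \<bar>m s - s\<bar> < e2"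
      "\<And>s. s \<in> {0..T+e1} \<Longrightarrow> \<bar>h (m s) - g s\<bar> < e2"
    using h unfolding J1_nhd_def by auto
  have pos: "l s \<ge> 0" if "s \<ge> 0" for s
    using l(1) that by (auto simp: time_changes_def)
  have "\<bar>m (l s) - s\<bar> < e1 + e2" if "s \<ge> 0" for s
    using l(2)[OF that] m(2)[OF pos[OF that]] by linarith
  moreover have "\<bar>h (m (l s)) - f s\<bar> < e1 + e2" if s: "s \<in> {0..T}" for s
  proof -
    have "l s \<in> {0..T+e1}" using l(2)[of s] pos[of s] s by auto
    from m(3)[OF this] l(3)[OF s] show ?thesis by linarith
  qed
  moreover have "h \<in> cadlag_space" using h unfolding J1_nhd_def by auto
  ultimately show ?thesis
    unfolding J1_nhd_def mem_Collect_eq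
    by (intro conjI bexI[OF _ time_changes_comp[OF l(1) m(1)]]) auto
qed

lemma openin_J1_topology:
  "openin J1_topology U \<longleftrightarrow>
     U \<subseteq> cadlag_space \<and> (\<forall>f\<in>U. \<exists>T>0. \<exists>e>0. J1_nhd f T e \<subseteq> U)"
proof -
  let ?P = "\<lambda>U. U \<subseteq> cadlag_space \<and> (\<forall>f\<in>U. \<exists>T>0. \<exists>e>0. J1_nhd f T e \<subseteq> U)"
  have "istopology ?P"
    unfolding istopology_def
  proof (intro conjI allI impI)
    fix S T assume S: "?P S" and T: "?P T"
    show "S \<inter> T \<subseteq> cadlag_space" using S by auto
    show "\<forall>f\<in>S \<inter> T. \<exists>A>0. \<exists>e>0. J1_nhd f A e \<subseteq> S \<inter> T"
    proof
      fix f assume f: "f \<in> S \<inter> T"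
      obtain A a where a: "A > 0" "a > 0" "J1_nhd f A a \<subseteq> S"
        using S f by blast
      obtain B b where b: "B > 0" "b > 0" "J1_nhd f B b \<subseteq> T"
        using T f by blast
      have "J1_nhd f (max A B) (min a b) \<subseteq> S \<inter> T"
        using a(3) b(3) J1_nhd_mono[of A "max A B" "min a b" a f]
          J1_nhd_mono[of B "max A B" "min a b" b f] by auto
      then show "\<exists>A>0. \<exists>e>0. J1_nhd f A e \<subseteq> S \<inter> T"
        using a(1,2) b(1,2) by (intro exI[of _ "max A B"] conjI exI[of _ "min a b"]) auto
    qed
  next
    fix K assume K: "\<forall>S\<in>K. ?P S"
    show "\<Union>K \<subseteq> cadlag_space" using K by auto
    show "\<forall>f\<in>\<Union>K. \<exists>T>0. \<exists>e>0. J1_nhd f T e \<subseteq> \<Union>K"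
    proof
      fix f assume "f \<in> \<Union>K"
      then obtain S where "S \<in> K" "f \<in> S" by auto
      then obtain T e where "T > 0" "e > 0" "J1_nhd f T e \<subseteq> S" using K by blast
      then show "\<exists>T>0. \<exists>e>0. J1_nhd f T e \<subseteq> \<Union>K" using \<open>S \<in> K\<close> by blast
    qed
  qed
  then show ?thesis unfolding J1_topology_def by simp
qed

lemma topspace_J1_topology [simp]: "topspace J1_topology = cadlag_space"
proof -
  have "openin J1_topology cadlag_space"
    unfolding openin_J1_topology J1_nhd_def using zero_less_one by blast
  then show ?thesis
    by (metis openin_J1_topology openin_subset openin_topspace subset_antisym)
qed

lemma J1_nhd_interior:
  assumes f: "f \<in> cadlag_space" and T: "T > 0" and e: "e > 0"
  shows "\<exists>U. openin J1_topology U \<and> f \<in> U \<and> U \<subseteq> J1_nhd f T e"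
proof -
  define U where "U = {g \<in> cadlag_space. \<exists>S>0. \<exists>d>0. J1_nhd g S d \<subseteq> J1_nhd f T e}"
  have "openin J1_topology U"
    unfolding openin_J1_topology
  proof (intro conjI ballI)
    show "U \<subseteq> cadlag_space" by (auto simp: U_def)
    fix g assume "g \<in> U"
    then obtain S d where Sd: "S > 0" "d > 0" "J1_nhd g S d \<subseteq> J1_nhd f T e"
      by (auto simp: U_def)
    have "J1_nhd g S (d/2) \<subseteq> U"
    proof
      fix h assume h: "h \<in> J1_nhd g S (d/2)"
      have "J1_nhd h (S + d/2) (d/2) \<subseteq> J1_nhd f T e"
        using J1_nhd_trans[OF h, of _ "d/2"] Sd(3) by auto
      moreover have "h \<in> cadlag_space" using h by (auto simp: J1_nhd_def)
      ultimately show "h \<in> U"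
        using Sd(1,2) unfolding U_def mem_Collect_eq
        by (intro conjI exI[of _ "S + d/2"] exI[of _ "d/2"]) auto
    qed
    then show "\<exists>S>0. \<exists>d>0. J1_nhd g S d \<subseteq> U"
      using Sd(1,2) by (intro exI[of _ S] conjI exI[of _ "d/2"]) auto
  qed
  moreover have "f \<in> U" using f T e unfolding U_def by blast
  moreover have "U \<subseteq> J1_nhd f T e" unfolding U_def using J1_nhd_self by blast
  ultimately show ?thesis by blast
qed

lemma limitin_J1_topology_nhd:
  assumes f: "f \<in> cadlag_space"
  shows "limitin J1_topology F f A \<longleftrightarrow> (\<forall>T>0. \<forall>e>0. \<forall>\<^sub>F n in A. F n \<in> J1_nhd f T e)"
    (is "?L \<longleftrightarrow> ?R")
proof
  assume L: ?L
  show ?R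
  proof (intro allI impI)
    fix T e :: real assume "T > 0" "e > 0"
    then obtain U where U: "openin J1_topology U" "f \<in> U" "U \<subseteq> J1_nhd f T e"
      using J1_nhd_interior[OF f] by blast
    have "\<forall>\<^sub>F n in A. F n \<in> U"
      using L[unfolded limitin_def, THEN conjunct2, rule_format, OF conjI[OF U(1,2)]] .
    then show "\<forall>\<^sub>F n in A. F n \<in> J1_nhd f T e"
      by (rule eventually_mono) (use U(3) in blast)
  qed
next
  assume R: ?R
  show ?L
    unfolding limitin_def
  proof (intro conjI allI impI)
    fix U assume "openin J1_topology U \<and> f \<in> U"
    then obtain T e where U: "T > 0" "e > 0" "J1_nhd f T e \<subseteq> U"
      unfolding openin_J1_topology by blast
    have "\<forall>\<^sub>F n in A. F n \<in> J1_nhd f T e"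
      using R[rule_format, OF U(1,2)] .
    then show "\<forall>\<^sub>F n in A. F n \<in> U"
      by (rule eventually_mono) (use U(3) in blast)
  qed (use f in simp)
qed

lemma limitin_J1_topology:
  assumes f: "f \<in> cadlag_space" and F: "\<And>n. F n \<in> cadlag_space"
  shows "limitin J1_topology F f sequentially \<longleftrightarrow>
    (\<exists>l. (\<forall>n. l n \<in> time_changes) \<and> uniform_limit {0..} l (\<lambda>s. s) sequentially \<and>
      (\<forall>N::nat. uniform_limit {0..real N} (\<lambda>n s. F n (l n s)) f sequentially))"
    (is "?L \<longleftrightarrow> ?R")
proof
  assume ?R
  then obtain l where l: "\<And>n. l n \<in> time_changes" "uniform_limit {0..} l (\<lambda>s. s) sequentially"
      "\<And>N::nat. uniform_limit {0..real N} (\<lambda>n s. F n (l n s)) f sequentially"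
    by blast
  have "\<forall>\<^sub>F n in sequentially. F n \<in> J1_nhd f T e" if "T > 0" "e > 0" for T e
  proof -
    obtain N :: nat where N: "T \<le> real N" using real_arch_simple by blast
    have "\<forall>\<^sub>F n in sequentially. \<forall>s\<in>{0..}. dist (l n s) s < e"
      using l(2) \<open>e > 0\<close> by (rule uniform_limitD)
    moreover have "\<forall>\<^sub>F n in sequentially. \<forall>s\<in>{0..real N}. dist (F n (l n s)) (f s) < e"
      using l(3) \<open>e > 0\<close> by (rule uniform_limitD)
    ultimately show ?thesis
    proof eventually_elim
      case (elim n)
      show ?case
        unfolding J1_nhd_def using F[of n] l(1)[of n] elim N by (auto simp: dist_real_def)
    qed
  qed
  then show ?L using limitin_J1_topology_nhd[OF f] by blast
next
  assume ?L
  define V where "V k = J1_nhd f (real (Suc k)) (1 / real (Suc k))" for k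
  have ev: "\<forall>\<^sub>F n in sequentially. F n \<in> V k" for k
    using \<open>?L\<close> unfolding limitin_J1_topology_nhd[OF f] V_def by simp
  define K where "K n = Max (insert 0 {k. k \<le> n \<and> F n \<in> V k})" for n
  have fin: "finite (insert 0 {k. k \<le> n \<and> F n \<in> V k})" for n
    by simp
  have inV: "F n \<in> V (K n)" if "F n \<in> V 0" for n
  proof -
    have "K n \<in> insert 0 {k. k \<le> n \<and> F n \<in> V k}" unfolding K_def using fin by (rule Max_in) simp
    then show ?thesis using that by auto
  qed
  have K_inf: "\<forall>\<^sub>F n in sequentially. K n \<ge> k \<and> F n \<in> V 0" for k
    using ev[of k] ev[of 0] eventually_ge_at_top[of k]
  proof eventually_elim
    case (elim n)
    then show ?case unfolding K_def using fin[of n] by (auto intro!: Max_ge)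
  qed
  define G where "G n l \<longleftrightarrow> l \<in> time_changes \<and> (F n \<in> V 0 \<longrightarrow>
      (\<forall>s\<ge>0. \<bar>l s - s\<bar> < 1 / real (Suc (K n))) \<and>
      (\<forall>s\<in>{0..real (Suc (K n))}. \<bar>F n (l s) - f s\<bar> < 1 / real (Suc (K n))))" for n l
  have "\<exists>l. G n l" for n
    using inV[of n] id_time_changes unfolding V_def J1_nhd_def G_def by blast
  then obtain l where l: "\<And>n. G n (l n)" by metis
  have small: "\<exists>k. N \<le> k \<and> 1 / real (Suc k) < e" if "e > 0" for e and N :: nat
  proof -
    obtain k where k: "1 / real (Suc k) < e"
      using nat_approx_posE[OF \<open>e > 0\<close>] by metis
    have "1 / real (Suc (max N k)) \<le> 1 / real (Suc k)" by (simp add: frac_le)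
    with k show ?thesis by (intro exI[of _ "max N k"]) auto
  qed
  have le: "1 / real (Suc m) \<le> 1 / real (Suc k)" if "k \<le> m" for k m
    using that by (simp add: frac_le)
  have "uniform_limit {0..} l (\<lambda>s. s) sequentially"
  proof (rule uniform_limitI)
    fix e :: real assume "e > 0"
    then obtain k where k: "1 / real (Suc k) < e" using small by blast
    show "\<forall>\<^sub>F n in sequentially. \<forall>s\<in>{0..}. dist (l n s) s < e"
      using K_inf[of k]
    proof eventually_elim
      case (elim n)
      then have "1 / real (Suc (K n)) < e" using k le[of k "K n"] by linarith
      then show ?case using l[of n] elim unfolding G_def by (force simp: dist_real_def)
    qed
  qed
  moreover have "uniform_limit {0..real N} (\<lambda>n s. F n (l n s)) f sequentially" for N :: nat
  proof (rule uniform_limitI)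
    fix e :: real assume "e > 0"
    then obtain k where k: "N \<le> k" "1 / real (Suc k) < e" using small by blast
    show "\<forall>\<^sub>F n in sequentially. \<forall>s\<in>{0..real N}. dist (F n (l n s)) (f s) < e"
      using K_inf[of k]
    proof eventually_elim
      case (elim n)
      then have *: "1 / real (Suc (K n)) < e" using k le[of k "K n"] by linarith
      show ?case
      proof
        fix s assume "s \<in> {0..real N}"
        then have "s \<in> {0..real (Suc (K n))}" using k(1) elim by auto
        then show "dist (F n (l n s)) (f s) < e"
          using l[of n] elim * unfolding G_def by (force simp: dist_real_def)
      qed
    qed
  qed
  ultimately show ?R using l unfolding G_def by blast
qed

end

theory Submission
  imports Defs
begin

text \<open>
  Sufficiency: let \<open>f\<^sub>n \<rightarrow> f\<close> in \<open>J\<^sub>1\<close> through time changes \<open>l\<^sub>n\<close>.  As \<open>{f = a}\<close> is null, the occupation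
  times \<open>A\<^sub>n\<close> of \<open>f\<^sub>n\<close> converge to \<open>A\<close>.  Convergence in \<open>J\<^sub>1\<close> is a local property: it suffices to find for
  each \<open>t\<close> points \<open>\<sigma>\<^sub>n(t) \<rightarrow> t\<close> such that near \<open>t\<close> the fast-forwarded \<open>f\<^sub>n\<close> is close to the left limit of
  the fast-forwarded \<open>f\<close> before \<open>\<sigma>\<^sub>n(t)\<close> and to its value at \<open>t\<close> after it.  At \<open>t\<close> the inverse of \<open>A\<close> jumps
  over an interval \<open>[s, s')\<close> with \<open>f \<le> a\<close>; take \<open>\<sigma>\<^sub>n(t) = A\<^sub>n(l\<^sub>n(\<rho>))\<close> with \<open>\<rho> = s'\<close> if \<open>f(s') > a\<close> and
  \<open>\<rho> = s\<close> otherwise.  Fast-forwarding only sees values \<open>\<ge> a\<close> of \<open>f\<^sub>n\<close>, so inside \<open>[s, s')\<close> it only sees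
  values near \<open>a\<close>, and by (1) this happens only if \<open>f(s-) = a\<close> or \<open>f(s') = a\<close>.

  Necessity: if an excursion as in (1) comes arbitrarily close to \<open>a\<close>, a small lift of \<open>f\<close> on a short
  interval makes a value near \<open>a\<close> visible between two stretches of values \<open>\<ge> a + \<epsilon>\<close>.  If \<open>{f = a}\<close> is
  not null, the fast-forwarded \<open>f + r\<close> spends at least the time \<open>\<lambda>{f = a}\<close> in \<open>(a, a + r]\<close> for every
  \<open>r > 0\<close>, whereas the fast-forwarded \<open>f\<close> is \<open>> a\<close> almost everywhere.
\<close>

section \<open>Cadlag functions\<close>

definition left_lim :: "(real \<Rightarrow> real) \<Rightarrow> real \<Rightarrow> real" where
  "left_lim f t = Lim (at_left t) f"

lemma left_lim_eqI: "(f \<longlongrightarrow> l) (at_left t) \<Longrightarrow> left_lim f t = l"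
  unfolding left_lim_def by (rule tendsto_Lim) simp

lemma cadlag_undefined:
  assumes "f \<in> cadlag_space" "t < 0" shows "f t = undefined"
  using assms by (auto simp: cadlag_space_def extensional_def)

text \<open>The definition of \<open>cadlag_space\<close> asks for left limits only at
  \<open>t > 0\<close>. At other \<open>t\<close> all points to the left carry the constant dummy
  value, so a limit exists there as well.\<close>

lemma cadlag_tendsto_left:
  assumes f: "f \<in> cadlag_space" shows "(f \<longlongrightarrow> left_lim f t) (at_left t)"
proof -
  have "\<exists>l. (f \<longlongrightarrow> l) (at_left t)"
  proof (cases "t > 0")
    case True
    then show ?thesis using f by (auto simp: cadlag_space_def)
  next
    case False
    have "\<forall>\<^sub>F x in at_left t. f x = undefined"
      using eventually_at_left_real[of "t - 1" t] False
      by (auto elim!: eventually_mono simp: cadlag_undefined[OF f])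
    then show ?thesis using tendsto_eventually by blast
  qed
  then show ?thesis using left_lim_eqI by metis
qed

lemma cadlag_tendsto_right:
  assumes f: "f \<in> cadlag_space" shows "(f \<longlongrightarrow> f t) (at_right t)"
proof (cases "t \<ge> 0")
  case True
  then show ?thesis using f by (auto simp: cadlag_space_def)
next
  case False
  then have "\<forall>\<^sub>F x in at_right t. f x = f t"
    using eventually_at_right_real[of t 0]
    by (auto elim!: eventually_mono simp: cadlag_undefined[OF f])
  then show ?thesis using tendsto_eventually by blast
qed

lemma cadlag_right_nhd:
  assumes f: "f \<in> cadlag_space" and e: "e > 0"
  obtains d where "d > 0" "\<And>s. t \<le> s \<Longrightarrow> s < t + d \<Longrightarrow> \<bar>f s - f t\<bar> < e"
proof -
  have "\<forall>\<^sub>F s in at_right t. \<bar>f s - f t\<bar> < e"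
    using tendstoD[OF cadlag_tendsto_right[OF f] e] by (simp add: dist_real_def)
  then obtain b where b: "b > t" "\<And>s. s > t \<Longrightarrow> s < b \<Longrightarrow> \<bar>f s - f t\<bar> < e"
    unfolding eventually_at_right_field by blast
  show ?thesis
  proof (rule that)
    show "b - t > 0" using b by simp
    show "\<bar>f s - f t\<bar> < e" if "t \<le> s" "s < t + (b - t)" for s
      using b(2)[of s] that e by (cases "s = t") auto
  qed
qed

lemma cadlag_left_nhd:
  assumes f: "f \<in> cadlag_space" and e: "e > 0"
  obtains d where "d > 0" "\<And>s. t - d < s \<Longrightarrow> s < t \<Longrightarrow> \<bar>f s - left_lim f t\<bar> < e"
proof -
  have "\<forall>\<^sub>F s in at_left t. \<bar>f s - left_lim f t\<bar> < e"
    using tendstoD[OF cadlag_tendsto_left[OF f] e] by (simp add: dist_real_def)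
  then obtain b where b: "b < t" "\<And>s. s > b \<Longrightarrow> s < t \<Longrightarrow> \<bar>f s - left_lim f t\<bar> < e"
    unfolding eventually_at_left_field by blast
  show ?thesis
    by (rule that[of "t - b"]) (use b in auto)
qed

lemma left_lim_le:
  assumes f: "f \<in> cadlag_space" and "x < t" and le: "\<And>s. x < s \<Longrightarrow> s < t \<Longrightarrow> f s \<le> c"
  shows "left_lim f t \<le> c"
proof (rule tendsto_upperbound[OF cadlag_tendsto_left[OF f]])
  show "\<forall>\<^sub>F s in at_left t. f s \<le> c"
    using eventually_at_left_real[OF \<open>x < t\<close>] by (rule eventually_mono) (use le in auto)
qed simp

text \<open>Right-continuity makes \<open>f\<close> the pointwise limit of its values at the next
  grid points strictly to the right. Each such value depends on \<open>x\<close> only through an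
  integer, hence is measurable in \<open>x\<close>.\<close>

lemma cadlag_measurable [measurable]:
  assumes f: "f \<in> cadlag_space" shows "f \<in> borel_measurable borel"
proof (rule borel_measurable_LIMSEQ_real)
  define p :: "nat \<Rightarrow> real \<Rightarrow> real" where
    "p n x = (\<lambda>i::int. (real_of_int i + 1) / real (Suc n)) \<lfloor>real (Suc n) * x\<rfloor>" for n x
  have p: "x < p n x" "p n x \<le> x + 1 / real (Suc n)" for n x
  proof -
    have "real (Suc n) * x < real_of_int \<lfloor>real (Suc n) * x\<rfloor> + 1" by linarith
    then show "x < p n x" unfolding p_def by (simp add: field_simps)
    have "real_of_int \<lfloor>real (Suc n) * x\<rfloor> + 1 \<le> real (Suc n) * x + 1" by linarith
    then have "p n x \<le> (real (Suc n) * x + 1) / real (Suc n)"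
      unfolding p_def by (intro divide_right_mono) auto
    then show "p n x \<le> x + 1 / real (Suc n)"
      by (simp add: add_divide_distrib)
  qed
  show "(\<lambda>n. f (p n x)) \<longlonglongrightarrow> f x" for x
  proof (rule filterlim_compose[OF cadlag_tendsto_right[OF f]])
    have "(\<lambda>n. x + 1 / real (Suc n)) \<longlonglongrightarrow> x + 0"
      by (intro tendsto_add tendsto_const) (rule LIMSEQ_Suc[OF lim_1_over_n])
    then have "(\<lambda>n. p n x) \<longlonglongrightarrow> x"
      by (intro tendsto_sandwich[OF _ _ tendsto_const, of x "\<lambda>n. p n x" _ "\<lambda>n. x + 1 / real (Suc n)"])
        (use p in \<open>auto intro!: always_eventually less_imp_le\<close>)
    then show "filterlim (\<lambda>n. p n x) (at_right x) sequentially"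
      by (rule tendsto_imp_filterlim_at_right) (use p in auto)
  qed
  show "(\<lambda>x. f (p n x)) \<in> borel_measurable borel" for n
    unfolding p_def by measurable
qed

text \<open>Choose for each point a rational strictly between it and all later points of the set;
  different points then get different rationals.\<close>

lemma countable_right_isolated:
  fixes S :: "real set"
  assumes "\<And>x. x \<in> S \<Longrightarrow> \<exists>d>0. {x<..<x+d} \<inter> S = {}"
  shows "countable S"
proof -
  have "\<exists>q. x \<in> S \<longrightarrow> q \<in> \<rat> \<and> x < q \<and> (\<forall>y\<in>S. x < y \<longrightarrow> q < y)" for x
  proof (cases "x \<in> S")
    case True
    then obtain d where d: "d > 0" "{x<..<x+d} \<inter> S = {}" using assms by blast
    obtain q where "q \<in> \<rat>" "x < q" "q < x + d"
      using Rats_dense_in_real[of x "x + d"] d(1) by auto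
    moreover have "q < y" if "y \<in> S" "x < y" for y
    proof (rule ccontr)
      assume "\<not> q < y"
      then have "y \<in> {x<..<x+d} \<inter> S" using that \<open>q < x + d\<close> by simp
      then show False using d(2) by simp
    qed
    ultimately show ?thesis by blast
  qed auto
  then obtain q where q: "\<And>x. x \<in> S \<Longrightarrow> q x \<in> \<rat> \<and> x < q x \<and> (\<forall>y\<in>S. x < y \<longrightarrow> q x < y)"
    by metis
  have "inj_on q S"
  proof (rule linorder_inj_onI)
    fix x y assume "x < y" "x \<in> S" "y \<in> S"
    then have "q x < y" "y < q y" using q by blast+
    then show "q x \<noteq> q y" by simp
  qed auto
  moreover have "countable (q ` S)"
    by (rule countable_subset[OF _ countable_rat]) (use q in auto)
  ultimately show ?thesis using countable_image_inj_on by blast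
qed

text \<open>Jumps larger than \<open>e\<close> are isolated from the right: just after any
  \<open>x\<close>, right-continuity confines the values, and hence the left limits, to within
  \<open>e / 2\<close> of \<open>f x\<close>.\<close>

lemma countable_cadlag_jumps:
  assumes f: "f \<in> cadlag_space" shows "countable {t. left_lim f t \<noteq> f t}"
proof -
  have "countable {t. \<bar>f t - left_lim f t\<bar> > e}" if "e > 0" for e
  proof (rule countable_right_isolated)
    fix x assume "x \<in> {t. \<bar>f t - left_lim f t\<bar> > e}"
    obtain d where d: "d > 0" "\<And>s. x \<le> s \<Longrightarrow> s < x + d \<Longrightarrow> \<bar>f s - f x\<bar> < e / 2"
      using cadlag_right_nhd[OF f, of "e / 2" x] \<open>e > 0\<close> by auto
    have "\<bar>f y - left_lim f y\<bar> \<le> e" if y: "x < y" "y < x + d" for y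
    proof -
      have *: "\<bar>f s - f x\<bar> < e / 2" if "x < s" "s < y" for s
        by (rule d(2)) (use that y in auto)
      have "left_lim f y \<le> f x + e / 2"
        by (rule left_lim_le[OF f \<open>x < y\<close>]) (smt (verit) *)
      moreover have "left_lim f y \<ge> f x - e / 2"
      proof (rule tendsto_lowerbound[OF cadlag_tendsto_left[OF f]])
        show "\<forall>\<^sub>F s in at_left y. f x - e / 2 \<le> f s"
          using eventually_at_left_real[OF \<open>x < y\<close>]
          by (rule eventually_mono) (smt (verit) * greaterThanLessThan_iff)
      qed simp
      moreover have "\<bar>f y - f x\<bar> < e / 2" using d(2) y by auto
      ultimately show ?thesis by linarith
    qed
    then have "{x<..<x+d} \<inter> {t. \<bar>f t - left_lim f t\<bar> > e} = {}" by force
    with d(1) show "\<exists>d>0. {x<..<x+d} \<inter> {t. \<bar>f t - left_lim f t\<bar> > e} = {}" by blast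
  qed
  then have "countable (\<Union>n::nat. {t. \<bar>f t - left_lim f t\<bar> > 1 / real (Suc n)})" by auto
  moreover have "{t. left_lim f t \<noteq> f t} \<subseteq> (\<Union>n::nat. {t. \<bar>f t - left_lim f t\<bar> > 1 / real (Suc n)})"
  proof
    fix t assume "t \<in> {t. left_lim f t \<noteq> f t}"
    then have "\<bar>f t - left_lim f t\<bar> > 0" by auto
    then show "t \<in> (\<Union>n::nat. {t. \<bar>f t - left_lim f t\<bar> > 1 / real (Suc n)})"
      using nat_approx_posE[of "\<bar>f t - left_lim f t\<bar>"] by (metis (mono_tags, lifting) UNIV_I UN_I mem_Collect_eq)
  qed
  ultimately show ?thesis using countable_subset by blast
qed

section \<open>Occupation time and its inverses\<close>

lemma fmeasurable_lborel_bounded: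
  fixes S :: "'a::euclidean_space set"
  assumes "S \<in> sets borel" "bounded S" shows "S \<in> fmeasurable lborel"
  using assms emeasure_bounded_finite by (auto intro!: fmeasurableI)

lemma time_above_eq:
  "time_above a f t = measure lborel ({0..t} \<inter> {z. a < f z})"
  unfolding time_above_def set_lebesgue_integral_def
  by (simp flip: indicator_inter_arith)

lemma above_fmeasurable:
  assumes "f \<in> cadlag_space" "I \<in> sets borel" "bounded I"
  shows "I \<inter> {z. a < f z} \<in> fmeasurable lborel"
proof (rule fmeasurable_lborel_bounded)
  have "{z. a < f z} \<in> sets borel" using cadlag_measurable[OF assms(1)] by simp
  then show "I \<inter> {z. a < f z} \<in> sets borel" using assms(2) by blast
qed (use assms(3) bounded_Int in blast)

lemma time_above_diff:
  assumes f: "f \<in> cadlag_space" and "0 \<le> x" "x \<le> y"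
  shows "time_above a f y - time_above a f x = measure lborel ({x<..<y} \<inter> {z. a < f z})"
proof -
  let ?B = "{z. a < f z}"
  have "{0..y} \<inter> ?B = ({0..x} \<inter> ?B) \<union> ({x<..y} \<inter> ?B)" using assms by auto
  then have "measure lborel ({0..y} \<inter> ?B) =
      measure lborel ({0..x} \<inter> ?B) + measure lborel ({x<..y} \<inter> ?B)"
    using above_fmeasurable[OF f, of "{0..x}" a] above_fmeasurable[OF f, of "{x<..y}" a]
    by (simp only:) (intro measure_Union, auto dest: fmeasurableD2 fmeasurableD)
  \<comment> \<open>Dropping the null end point allows later bounds on \<open>f\<close> to be
    assumed only strictly between \<open>x\<close> and \<open>y\<close>.\<close>
  also have "measure lborel ({x<..y} \<inter> ?B) = measure lborel ({x<..<y} \<inter> ?B)"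
  proof (rule measure_eq_AE)
    show "AE z in lborel. z \<in> {x<..y} \<inter> ?B \<longleftrightarrow> z \<in> {x<..<y} \<inter> ?B"
      using AE_lborel_singleton[of y] by eventually_elim auto
  qed (use above_fmeasurable[OF f, of "{x<..y}" a] above_fmeasurable[OF f, of "{x<..<y}" a] in
      \<open>auto dest: fmeasurableD\<close>)
  finally show ?thesis by (simp add: time_above_eq)
qed

lemma time_above_0 [simp]: "time_above a f 0 = 0"
proof -
  have "measure lborel ({0::real} \<inter> {z. a < f z}) = 0"
    by (cases "a < f 0") (auto simp: Int_insert_left)
  then show ?thesis by (simp add: time_above_eq)
qed

lemma time_above_mono:
  assumes "f \<in> cadlag_space" "0 \<le> x" "x \<le> y"
  shows "time_above a f x \<le> time_above a f y"
  using time_above_diff[OF assms, of a] by (smt (verit) measure_nonneg)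

lemma time_above_nonneg: "time_above a f t \<ge> 0"
  by (simp add: time_above_eq)

lemma time_above_le:
  assumes "f \<in> cadlag_space" "0 \<le> x" "x \<le> y"
  shows "time_above a f y - time_above a f x \<le> y - x"
proof -
  have "measure lborel ({x<..<y} \<inter> {z. a < f z}) \<le> measure lborel {x<..<y}"
    using above_fmeasurable[OF assms(1), of "{x<..<y}" a]
    by (intro measure_mono_fmeasurable fmeasurable_lborel_bounded) auto
  then show ?thesis using time_above_diff[OF assms, of a] assms by simp
qed

lemma time_above_lipschitz:
  assumes "f \<in> cadlag_space" "0 \<le> x" "0 \<le> y"
  shows "\<bar>time_above a f y - time_above a f x\<bar> \<le> \<bar>y - x\<bar>"
  using time_above_le[OF assms(1), of x y a] time_above_le[OF assms(1), of y x a]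
    time_above_mono[OF assms(1), of x y a] time_above_mono[OF assms(1), of y x a] assms
  by (cases "x \<le> y") auto

lemma time_above_diff_above:
  assumes f: "f \<in> cadlag_space" and "0 \<le> x" "x \<le> y" "\<And>z. x < z \<Longrightarrow> z < y \<Longrightarrow> a < f z"
  shows "time_above a f y - time_above a f x = y - x"
proof -
  have "{x<..<y} \<inter> {z. a < f z} = {x<..<y}" using assms by auto
  then show ?thesis using time_above_diff[OF assms(1-3), of a] assms by simp
qed

lemma time_above_diff_below:
  assumes f: "f \<in> cadlag_space" and "0 \<le> x" "x \<le> y" "\<And>z. x < z \<Longrightarrow> z < y \<Longrightarrow> f z \<le> a"
  shows "time_above a f y = time_above a f x"
proof -
  have "{x<..<y} \<inter> {z. a < f z} = {}" using assms(4) by force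
  then show ?thesis using time_above_diff[OF assms(1-3), of a] assms by simp
qed

text \<open>By right-continuity a value above \<open>a\<close> would persist on a short interval, on
  which the occupation time grows with slope one.\<close>

lemma time_above_eqD:
  assumes f: "f \<in> cadlag_space" and "0 \<le> x" and eq: "time_above a f x = time_above a f y"
    and z: "x \<le> z" "z < y"
  shows "f z \<le> a"
proof (rule ccontr)
  assume "\<not> f z \<le> a"
  then have pos: "f z - a > 0" by simp
  obtain d where d: "d > 0" "\<And>s. z \<le> s \<Longrightarrow> s < z + d \<Longrightarrow> \<bar>f s - f z\<bar> < f z - a"
    using cadlag_right_nhd[OF f pos, of z] by blast
  define w where "w = min y (z + d)"
  have w: "z < w" "w \<le> y" using d(1) z by (auto simp: w_def)
  have "a < f s" if "z < s" "s < w" for s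
    using d(2)[of s] that by (auto simp: w_def abs_less_iff)
  then have "time_above a f w - time_above a f z = w - z"
    using time_above_diff_above[OF f, of z w a] z w \<open>0 \<le> x\<close> by auto
  moreover have "time_above a f x \<le> time_above a f z" "time_above a f w \<le> time_above a f y"
    using time_above_mono[OF f] \<open>0 \<le> x\<close> z w by auto
  ultimately show False using eq w by linarith
qed

text \<open>The left limit of \<^const>\<open>time_above_inv\<close>.\<close>

definition time_above_linv :: "real \<Rightarrow> (real \<Rightarrow> real) \<Rightarrow> real \<Rightarrow> real" where
  "time_above_linv a f t = Inf {s. s \<ge> 0 \<and> t \<le> time_above a f s}"

section \<open>Inverses of the occupation time and the fast-forwarded function\<close>

locale infinite_time_above =
  fixes a :: real and f :: "real \<Rightarrow> real"
  assumes between: "f \<in> cadlag_between (ereal a) \<infinity>"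
begin

abbreviation "A \<equiv> time_above a f"
abbreviation "Ainv \<equiv> time_above_inv a f"
abbreviation "Alinv \<equiv> time_above_linv a f"
abbreviation "ff \<equiv> left_fast_forward a f"

lemma cadlag: "f \<in> cadlag_space"
  using between by (simp add: cadlag_between_def)

text \<open>A bound on \<open>A\<close> would, by continuity from below, bound the measure of
  \<open>{f > a}\<close> on the half-line, which is infinite.\<close>

lemma time_above_unbounded: "\<exists>s\<ge>0. t < A s"
proof (rule ccontr)
  assume "\<not> ?thesis"
  then have le: "A s \<le> t" if "s \<ge> 0" for s using that by (auto simp: not_less)
  define B where "B n = {0..real n} \<inter> {z. a < f z}" for n
  have B: "B n \<in> fmeasurable lborel" for n
    unfolding B_def by (rule above_fmeasurable[OF cadlag]) auto
  have "emeasure lborel (B n) \<le> ennreal t" for n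
  proof -
    have "emeasure lborel (B n) = ennreal (A (real n))"
      using fmeasurableD2[OF B[of n]] unfolding time_above_eq B_def
      by (simp add: emeasure_eq_ennreal_measure)
    then show ?thesis using le[of "real n"] by (simp add: ennreal_leI)
  qed
  moreover have "(SUP n. emeasure lborel (B n)) = emeasure lborel (\<Union>n. B n)"
    using fmeasurableD[OF B] by (intro SUP_emeasure_incseq) (auto simp: incseq_def dest: fmeasurableD, auto simp: B_def)
  moreover have "(\<Union>n. B n) = {z \<in> {0..}. ereal a < ereal (f z) \<and> ereal (f z) < \<infinity>}"
    unfolding B_def using real_arch_simple by auto
  ultimately have "emeasure lborel {z \<in> {0..}. ereal a < ereal (f z) \<and> ereal (f z) < \<infinity>} \<le> ennreal t"
    by (metis SUP_least)
  then show False using between by (simp add: cadlag_between_def top_unique)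
qed

lemma mono_A: "0 \<le> x \<Longrightarrow> x \<le> y \<Longrightarrow> A x \<le> A y"
  by (rule time_above_mono[OF cadlag])

text \<open>The Galois correspondence between \<open>A\<close> and its right-continuous inverse; it
  rests on the continuity of \<open>A\<close> and reduces most questions about \<open>Ainv\<close>
  to questions about \<open>A\<close>.\<close>

lemma inv_less_iff:
  assumes "t \<ge> 0" "s \<ge> 0" shows "Ainv t < s \<longleftrightarrow> t < A s"
proof -
  let ?S = "{s. s > 0 \<and> A s > t}"
  have bdd: "bdd_below ?S" by (rule bdd_belowI[of _ 0]) auto
  obtain s0 where "s0 \<ge> 0" "t < A s0" using time_above_unbounded by blast
  then have "s0 \<in> ?S" using assms by (cases "s0 = 0") auto
  then have ne: "?S \<noteq> {}" by blast
  show ?thesis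
  proof
    assume "Ainv t < s"
    then obtain s' where "s' \<in> ?S" "s' < s"
      using cInf_lessD[OF ne] unfolding time_above_inv_def by blast
    then show "t < A s" using mono_A[of s' s] by auto
  next
    assume less: "t < A s"
    \<comment> \<open>Stepping back by at most half of the excess \<open>A s - t\<close> keeps
      \<open>A\<close> above \<open>t\<close>, since \<open>A\<close> is 1-Lipschitz. The
      \<open>min\<close> keeps \<open>s'\<close> nonnegative.\<close>
    define s' where "s' = s - min s ((A s - t) / 2)"
    have "s > 0" using less assms by (cases "s = 0") auto
    then have "0 < min s ((A s - t) / 2)" using less by simp
    then have s': "s' < s" "0 \<le> s'" "s - s' \<le> (A s - t) / 2"
      unfolding s'_def by linarith+
    then have "A s - A s' \<le> (A s - t) / 2"
      using time_above_le[OF cadlag, of s' s a] by linarith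
    then have "A s' > t" using less by (simp add: field_simps)
    moreover have "s' \<noteq> 0"
    proof
      assume "s' = 0"
      then show False using \<open>A s' > t\<close> \<open>t \<ge> 0\<close> by simp
    qed
    ultimately have "Ainv t \<le> s'"
      unfolding time_above_inv_def using s' by (intro cInf_lower bdd) auto
    then show "Ainv t < s" using s' by simp
  qed
qed

lemma linv_le_iff:
  assumes "s \<ge> 0" shows "Alinv t \<le> s \<longleftrightarrow> t \<le> A s"
proof -
  let ?S = "{s. s \<ge> 0 \<and> t \<le> A s}"
  have bdd: "bdd_below ?S" by (rule bdd_belowI[of _ 0]) auto
  have ne: "?S \<noteq> {}" using time_above_unbounded[of t] by (auto intro: less_imp_le)
  show ?thesis
  proof
    assume le: "Alinv t \<le> s"
    show "t \<le> A s"
    proof (rule field_le_epsilon)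
      fix e :: real assume "e > 0"
      then have "Inf ?S < s + e" using le unfolding time_above_linv_def by simp
      then obtain s' where "s' \<in> ?S" "s' < s + e" using cInf_lessD[OF ne] by blast
      then have "t \<le> A (s + e)" using mono_A[of s' "s + e"] by auto
      then show "t \<le> A s + e"
        using time_above_le[OF cadlag, of s "s + e" a] assms \<open>e > 0\<close> by simp
    qed
  next
    assume "t \<le> A s"
    then show "Alinv t \<le> s"
      unfolding time_above_linv_def using assms by (intro cInf_lower bdd) auto
  qed
qed

lemma inv_nonneg: "Ainv t \<ge> 0" if "t \<ge> 0"
  using inv_less_iff[of t 0] that by fastforce

lemma linv_nonneg: "Alinv t \<ge> 0"
  unfolding time_above_linv_def
  using time_above_unbounded[of t] by (intro cInf_greatest) (auto intro: less_imp_le)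

lemma A_inv [simp]: "A (Ainv t) = t" if "t \<ge> 0"
proof (rule antisym)
  show "A (Ainv t) \<le> t"
    using inv_less_iff[OF that inv_nonneg[OF that]] by simp
  show "t \<le> A (Ainv t)"
  proof (rule field_le_epsilon)
    fix e :: real assume "e > 0"
    then have "t < A (Ainv t + e)"
      using inv_less_iff[OF that, of "Ainv t + e"] inv_nonneg[OF that] by simp
    then show "t \<le> A (Ainv t) + e"
      using time_above_le[OF cadlag, of "Ainv t" "Ainv t + e" a] inv_nonneg[OF that] \<open>e > 0\<close> by simp
  qed
qed

lemma A_linv [simp]: "A (Alinv t) = t" if "t \<ge> 0"
proof (rule antisym)
  show "t \<le> A (Alinv t)"
    using linv_le_iff[OF linv_nonneg, of t t] by simp
  show "A (Alinv t) \<le> t"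
    using linv_le_iff[of "Ainv t" t] inv_nonneg[OF that] A_inv[OF that] linv_nonneg mono_A[of "Alinv t" "Ainv t"] that
    by simp
qed

lemma linv_le_inv: "Alinv t \<le> Ainv t" if "t \<ge> 0"
  using linv_le_iff[of "Ainv t" t] inv_nonneg[OF that] that by simp

lemma inv_strict_mono: "Ainv s < Ainv t" if "0 \<le> s" "s < t"
  using inv_less_iff[of s "Ainv t"] inv_nonneg[of t] that by simp

lemma inv_less_linv: "Ainv s < Alinv t" if "0 \<le> s" "s < t"
  using inv_less_iff[of s "Alinv t"] linv_nonneg[of t] that by simp

lemma linv_pos: "Alinv t > 0" if "t > 0"
  using inv_less_linv[of 0 t] inv_nonneg[of 0] that by simp

text \<open>\<open>A\<close> grows immediately to the right of \<open>Ainv t\<close>, so values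
  above \<open>a\<close> occur arbitrarily close to it, and right-continuity preserves the weak
  inequality. Fast-forwarding thus sees no value below \<open>a\<close>.\<close>

lemma f_inv_ge: "f (Ainv t) \<ge> a" if "t \<ge> 0"
proof (rule field_le_epsilon)
  fix e :: real assume "e > 0"
  then obtain d where d: "d > 0" "\<And>s. Ainv t \<le> s \<Longrightarrow> s < Ainv t + d \<Longrightarrow> \<bar>f s - f (Ainv t)\<bar> < e"
    using cadlag_right_nhd[OF cadlag, of e "Ainv t"] by blast
  have "A (Ainv t) < A (Ainv t + d)"
    using inv_less_iff[of t "Ainv t + d"] inv_nonneg[OF that] that d(1) by simp
  then obtain z where "Ainv t < z" "z < Ainv t + d" "f z > a"
    using time_above_diff_below[OF cadlag inv_nonneg[OF \<open>t \<ge> 0\<close>], of "Ainv t + d" a] d(1)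
    by (metis less_irrefl less_eq_real_def less_add_same_cancel1 linorder_not_less)
  then show "a \<le> f (Ainv t) + e" using d(2)[of z] by linarith
qed

text \<open>\<open>A\<close> equals \<open>t\<close> at both ends; this is the stretch that
  fast-forwarding skips at time \<open>t\<close>.\<close>

lemma below_between:
  assumes "t \<ge> 0" "Alinv t \<le> z" "z < Ainv t" shows "f z \<le> a"
  by (rule time_above_eqD[OF cadlag linv_nonneg[of t], of a "Ainv t"]) (use assms in auto)

lemma tendsto_inv_right: "filterlim Ainv (at_right (Ainv t)) (at_right t)" if "t \<ge> 0"
proof (rule tendsto_imp_filterlim_at_right)
  show "(Ainv \<longlongrightarrow> Ainv t) (at_right t)"
  proof (rule order_tendstoI)
    fix y assume "y < Ainv t"
    then show "\<forall>\<^sub>F x in at_right t. y < Ainv x"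
      using inv_strict_mono[OF that]
      by (intro eventually_mono[OF eventually_at_right_less]) (meson less_trans)
  next
    fix y assume "Ainv t < y"
    then have "t < A y" using inv_less_iff[of t y] inv_nonneg[OF that] that by simp
    then show "\<forall>\<^sub>F x in at_right t. Ainv x < y"
      using inv_less_iff[of _ y] inv_nonneg[OF that] that \<open>Ainv t < y\<close>
      by (intro eventually_mono[OF eventually_at_right_real[OF \<open>t < A y\<close>]]) auto
  qed
  show "\<forall>\<^sub>F x in at_right t. Ainv t < Ainv x"
    using eventually_at_right_less by (rule eventually_mono) (use inv_strict_mono[OF that] in auto)
qed

text \<open>The approach to \<open>Alinv t\<close> is strictly from the left, so the left limit of
  \<open>ff\<close> at \<open>t\<close> is that of \<open>f\<close> at \<open>Alinv t\<close>,
  whatever happens between \<open>Alinv t\<close> and \<open>Ainv t\<close>.\<close>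

lemma tendsto_inv_left: "filterlim Ainv (at_left (Alinv t)) (at_left t)" if "t > 0"
proof (rule tendsto_imp_filterlim_at_left)
  have ev: "\<forall>\<^sub>F x in at_left t. Ainv x < Alinv t"
    using eventually_at_left_real[OF that] by (rule eventually_mono) (use inv_less_linv in auto)
  show "(Ainv \<longlongrightarrow> Alinv t) (at_left t)"
  proof (rule order_tendstoI)
    fix y assume y: "y < Alinv t"
    show "\<forall>\<^sub>F x in at_left t. y < Ainv x"
    proof (cases "y \<ge> 0")
      case True
      then have "max 0 (A y) < t" using linv_le_iff[of y t] y that by auto
      then show ?thesis
      proof (rule eventually_mono[OF eventually_at_left_real])
        fix x assume x: "x \<in> {max 0 (A y)<..<t}"
        show "y < Ainv x"
        proof (rule ccontr)
          assume "\<not> y < Ainv x"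
          then have "A (Ainv x) \<le> A y" using mono_A[of "Ainv x" y] inv_nonneg[of x] x by simp
          then show False using x by simp
        qed
      qed
    next
      case False
      then have "y < Ainv x" if "x \<in> {0<..<t}" for x using inv_nonneg[of x] that by simp
      then show ?thesis
        using eventually_at_left_real[OF that] by (rule eventually_mono[rotated])
    qed
  next
    fix y assume "Alinv t < y"
    then show "\<forall>\<^sub>F x in at_left t. Ainv x < y" using ev by (auto elim!: eventually_mono)
  qed
  show "\<forall>\<^sub>F x in at_left t. Ainv x < Alinv t" by (rule ev)
qed

lemma ff_eq: "t \<ge> 0 \<Longrightarrow> ff t = f (Ainv t)"
  by (simp add: left_fast_forward_def)

lemma ff_tendsto_left: "(ff \<longlongrightarrow> left_lim f (Alinv t)) (at_left t)" if "t > 0"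
proof -
  have "((\<lambda>x. f (Ainv x)) \<longlongrightarrow> left_lim f (Alinv t)) (at_left t)"
    by (rule filterlim_compose[OF cadlag_tendsto_left[OF cadlag] tendsto_inv_left[OF that]])
  moreover have "\<forall>\<^sub>F x in at_left t. f (Ainv x) = ff x"
    using eventually_at_left_real[OF that] by (rule eventually_mono) (simp add: ff_eq)
  ultimately show ?thesis by (rule Lim_transform_eventually)
qed

lemma left_lim_ff: "t > 0 \<Longrightarrow> left_lim ff t = left_lim f (Alinv t)"
  using left_lim_eqI[OF ff_tendsto_left] .

lemma ff_cadlag: "ff \<in> cadlag_space"
proof -
  have "(ff \<longlongrightarrow> ff t) (at_right t)" if "t \<ge> 0" for t
  proof -
    have "((\<lambda>x. f (Ainv x)) \<longlongrightarrow> f (Ainv t)) (at_right t)"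
      by (rule filterlim_compose[OF cadlag_tendsto_right[OF cadlag] tendsto_inv_right[OF that]])
    moreover have "\<forall>\<^sub>F x in at_right t. f (Ainv x) = ff x"
      using eventually_at_right_less[of t] by (rule eventually_mono) (use that ff_eq in auto)
    ultimately show ?thesis using ff_eq[OF that] by (simp add: Lim_transform_eventually)
  qed
  moreover have "ff \<in> extensional {0..}" by (simp add: left_fast_forward_def)
  ultimately show ?thesis
    unfolding cadlag_space_def using ff_tendsto_left by blast
qed

lemma left_lim_linv_ge: "left_lim f (Alinv t) \<ge> a" if "t > 0"
  by (rule tendsto_lowerbound[OF ff_tendsto_left[OF that]])
    (rule eventually_mono[OF eventually_at_left_real[OF that]], auto simp: ff_eq f_inv_ge)

end

section \<open>A local criterion for convergence in the \<open>J\<^sub>1\<close> topology\<close>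

text \<open>A jump of \<open>h\<close> at \<open>t\<close> is matched with a rapid change of \<open>H n\<close> at \<open>\<sigma> n\<close>.\<close>

definition locally_close ::
    "(nat \<Rightarrow> real \<Rightarrow> real) \<Rightarrow> (nat \<Rightarrow> real) \<Rightarrow> (real \<Rightarrow> real) \<Rightarrow> real \<Rightarrow> bool" where
  "locally_close H \<sigma> h t \<longleftrightarrow> (\<forall>e>0. \<exists>d>0. \<forall>\<^sub>F n in sequentially. \<forall>u\<ge>0.
     \<bar>u - t\<bar> < d \<longrightarrow> \<bar>H n u - (if u < \<sigma> n then left_lim h t else h t)\<bar> < e)"

text \<open>Write \<open>u\<close> as \<open>l n s\<close>. Then \<open>F n u\<close> is close to
  \<open>f s\<close>, and \<open>s < t\<close> is equivalent to \<open>u < l n t\<close>, so the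
  side of \<open>l n t\<close> decides whether \<open>f s\<close> is near the left limit or near the
  value at \<open>t\<close>.\<close>

lemma locally_close_time_changes:
  assumes f: "f \<in> cadlag_space" and l: "\<And>n. l n \<in> time_changes"
    and lim: "uniform_limit {0..} l (\<lambda>s. s) sequentially"
    and F: "\<And>N::nat. uniform_limit {0..real N} (\<lambda>n s. F n (l n s)) f sequentially"
    and t: "t \<ge> 0"
  shows "locally_close F (\<lambda>n. l n t) f t"
  unfolding locally_close_def
proof (intro allI impI)
  fix e :: real assume "e > 0"
  then have e2: "e / 2 > 0" by simp
  obtain d1 where d1: "d1 > 0" "\<And>s. t \<le> s \<Longrightarrow> s < t + d1 \<Longrightarrow> \<bar>f s - f t\<bar> < e / 2"
    using cadlag_right_nhd[OF f e2] by blast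
  obtain d2 where d2: "d2 > 0" "\<And>s. t - d2 < s \<Longrightarrow> s < t \<Longrightarrow> \<bar>f s - left_lim f t\<bar> < e / 2"
    using cadlag_left_nhd[OF f e2] by blast
  define D where "D = min d1 d2"
  have D: "D > 0" "D \<le> d1" "D \<le> d2" using d1 d2 by (auto simp: D_def)
  obtain N :: nat where N: "t + D \<le> real N" using real_arch_simple by blast
  \<comment> \<open>Half of \<open>D\<close> for the time change and half for
    \<open>\<bar>u - t\<bar>\<close> place \<open>s\<close> within \<open>D\<close> of
    \<open>t\<close>.\<close>
  have "\<forall>\<^sub>F n in sequentially. \<forall>s\<in>{0..}. dist (l n s) s < D / 2"
    using uniform_limitD[OF lim, of "D / 2"] D by simp
  moreover have "\<forall>\<^sub>F n in sequentially. \<forall>s\<in>{0..real N}. dist (F n (l n s)) (f s) < e / 2"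
    using uniform_limitD[OF F e2] by simp
  ultimately have "\<forall>\<^sub>F n in sequentially. \<forall>u\<ge>0.
      \<bar>u - t\<bar> < D / 2 \<longrightarrow> \<bar>F n u - (if u < l n t then left_lim f t else f t)\<bar> < e"
  proof eventually_elim
    case (elim n)
    show ?case
    proof (intro allI impI)
      fix u :: real assume u: "0 \<le> u" "\<bar>u - t\<bar> < D / 2"
      have "u \<in> l n ` {0..}" using l[of n] u by (auto simp: time_changes_def)
      then obtain s where s: "s \<ge> 0" "u = l n s" by auto
      have "\<bar>u - s\<bar> < D / 2" using elim(1) s by (auto simp: dist_real_def)
      then have st: "\<bar>s - t\<bar> < D" using u by linarith
      then have "\<bar>F n u - f s\<bar> < e / 2" using elim(2) s N by (auto simp: dist_real_def)
      moreover have iff: "u < l n t \<longleftrightarrow> s < t"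
        using strict_mono_on_less[of "{0..}" "l n" s t] l[of n] s t by (auto simp: time_changes_def)
      moreover have "\<bar>f s - (if s < t then left_lim f t else f t)\<bar> < e / 2"
        using d1(2)[of s] d2(2)[of s] st D by auto
      ultimately have "\<bar>F n u - (if s < t then left_lim f t else f t)\<bar> < e"
        by linarith
      then show "\<bar>F n u - (if u < l n t then left_lim f t else f t)\<bar> < e"
        using iff by simp
    qed
  qed
  then show "\<exists>d>0. \<forall>\<^sub>F n in sequentially. \<forall>u\<ge>0.
      \<bar>u - t\<bar> < d \<longrightarrow> \<bar>F n u - (if u < l n t then left_lim f t else f t)\<bar> < e"
    using D by (intro exI[of _ "D / 2"]) auto
qed

text \<open>A piece of a time change, taking \<open>[x, y]\<close> onto \<open>[p, q]\<close>.\<close>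

definition J1_match ::
    "real \<Rightarrow> (real \<Rightarrow> real) \<Rightarrow> (real \<Rightarrow> real) \<Rightarrow> real \<Rightarrow> real \<Rightarrow> real \<Rightarrow> real \<Rightarrow> bool" where
  "J1_match e h g x y p q \<longleftrightarrow> (\<exists>l. strict_mono_on {x..y} l \<and> continuous_on {x..y} l \<and>
     l x = p \<and> l y = q \<and> (\<forall>s\<in>{x..y}. \<bar>l s - s\<bar> < e) \<and> (\<forall>s\<in>{x..<y}. \<bar>g (l s) - h s\<bar> < e))"

lemma J1_match_refl: "\<bar>p - x\<bar> < e \<Longrightarrow> J1_match e h g x x p p"
  unfolding J1_match_def by (rule exI[of _ "\<lambda>_. p"]) (auto simp: strict_mono_on_def)

lemma strict_mono_on_If:
  fixes l m :: "real \<Rightarrow> real"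
  assumes "strict_mono_on {s\<in>I. s \<le> y} l" "strict_mono_on {s\<in>I. y \<le> s} m" "l y = m y" "y \<in> I"
  shows "strict_mono_on I (\<lambda>s. if s \<le> y then l s else m s)"
proof (rule strict_mono_onI)
  fix r s assume rs: "r \<in> I" "s \<in> I" "r < s"
  consider "s \<le> y" | "y < r" | "r \<le> y" "y < s" by linarith
  then show "(if r \<le> y then l r else m r) < (if s \<le> y then l s else m s)"
  proof cases
    case 1
    then show ?thesis using strict_mono_onD[OF assms(1), of r s] rs by auto
  next
    case 2
    then show ?thesis using strict_mono_onD[OF assms(2), of r s] rs by auto
  next
    case 3
    have "l r \<le> l y" using strict_mono_onD[OF assms(1), of r y] rs 3 assms(4) by (cases "r = y") auto
    moreover have "m y < m s" using strict_mono_onD[OF assms(2), of y s] rs 3 assms(4) by auto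
    ultimately show ?thesis using assms(3) 3 by simp
  qed
qed

text \<open>A match compares values on a half-open interval, so the value at the junction
  \<open>y\<close> is left to the second piece and a jump of \<open>h\<close> there does no
  harm.\<close>

lemma J1_match_trans:
  assumes 1: "J1_match e h g x y p q" and 2: "J1_match e h g y z q r" and le: "x \<le> y" "y \<le> z"
  shows "J1_match e h g x z p r"
proof -
  obtain l where l: "strict_mono_on {x..y} l" "continuous_on {x..y} l" "l x = p" "l y = q"
      "\<And>s. s \<in> {x..y} \<Longrightarrow> \<bar>l s - s\<bar> < e" "\<And>s. s \<in> {x..<y} \<Longrightarrow> \<bar>g (l s) - h s\<bar> < e"
    using 1 unfolding J1_match_def by blast
  obtain m where m: "strict_mono_on {y..z} m" "continuous_on {y..z} m" "m y = q" "m z = r"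
      "\<And>s. s \<in> {y..z} \<Longrightarrow> \<bar>m s - s\<bar> < e" "\<And>s. s \<in> {y..<z} \<Longrightarrow> \<bar>g (m s) - h s\<bar> < e"
    using 2 unfolding J1_match_def by blast
  define k where "k = (\<lambda>s. if s \<le> y then l s else m s)"
  have k: "k s = l s" if "s \<le> y" for s using that by (simp add: k_def)
  have k': "k s = m s" if "y \<le> s" for s using that l(4) m(3) by (auto simp: k_def)
  have split: "{s \<in> {x..z}. s \<le> y} = {x..y}" "{s \<in> {x..z}. y \<le> s} = {y..z}" using le by auto
  have "strict_mono_on {x..z} k"
    unfolding k_def by (rule strict_mono_on_If) (use l m le split in auto)
  moreover have "continuous_on ({x..y} \<union> {y..z}) k"
    unfolding k_def using l m by (intro continuous_on_cases) auto
  then have "continuous_on {x..z} k" using le by (simp add: ivl_disj_un_two_touch)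
  moreover have "\<bar>k s - s\<bar> < e" if "s \<in> {x..z}" for s
    using l(5)[of s] m(5)[of s] that k k' by (cases "s \<le> y") auto
  moreover have "\<bar>g (k s) - h s\<bar> < e" if "s \<in> {x..<z}" for s
    using l(6)[of s] m(6)[of s] that k k' by (cases "s < y") auto
  moreover have "k x = p" "k z = r" using k k' le l m by auto
  ultimately show ?thesis unfolding J1_match_def by blast
qed

text \<open>The affine map works: its displacement at \<open>s\<close> is a convex combination of
  the displacements at the two end points.\<close>

lemma J1_match_linear:
  assumes xy: "x < y" and pq: "p < q" and px: "\<bar>p - x\<bar> < e" and qy: "\<bar>q - y\<bar> < e"
    and close: "\<And>s u. s \<in> {x..<y} \<Longrightarrow> u \<in> {p..<q} \<Longrightarrow> \<bar>g u - h s\<bar> < e"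
  shows "J1_match e h g x y p q"
proof -
  define c where "c = (q - p) / (y - x)"
  define l where "l s = p + (s - x) * c" for s
  have c: "c > 0" using xy pq by (simp add: c_def)
  have lx: "l x = p" and ly: "l y = q" using xy by (simp_all add: l_def c_def)
  have mono: "strict_mono l" using c by (auto simp: strict_mono_def l_def)
  have "\<bar>l s - s\<bar> < e" if s: "s \<in> {x..y}" for s
  proof -
    define \<theta> where "\<theta> = (s - x) / (y - x)"
    have th: "0 \<le> \<theta>" "\<theta> \<le> 1" using s xy by (auto simp: \<theta>_def)
    have "s - x = \<theta> * (y - x)" using xy by (simp add: \<theta>_def)
    moreover have "(s - x) * c = \<theta> * (q - p)" by (simp add: \<theta>_def c_def)
    ultimately have eq: "l s - s = (1 - \<theta>) * (p - x) + \<theta> * (q - y)"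
      by (simp add: l_def algebra_simps)
    have "\<bar>(1 - \<theta>) * (p - x) + \<theta> * (q - y)\<bar> \<le> (1 - \<theta>) * \<bar>p - x\<bar> + \<theta> * \<bar>q - y\<bar>"
      using th by (intro abs_triangle_ineq[THEN order_trans]) (simp add: abs_mult)
    also have "\<dots> < e" using convex_bound_lt[OF px qy, of "1 - \<theta>" \<theta>] th by simp
    finally show ?thesis using eq by simp
  qed
  moreover have "\<bar>g (l s) - h s\<bar> < e" if s: "s \<in> {x..<y}" for s
  proof (rule close[OF s])
    show "l s \<in> {p..<q}"
      using s strict_mono_less[OF mono, of s y] strict_mono_less_eq[OF mono, of x s] lx ly by simp
  qed
  moreover have "continuous_on {x..y} l" unfolding l_def by (intro continuous_intros)
  moreover have "strict_mono_on {x..y} l" using mono by (auto simp: strict_mono_def strict_mono_on_def)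
  ultimately show ?thesis unfolding J1_match_def using lx ly by blast
qed

text \<open>Beyond \<open>T'\<close> the time change continues as a translation, with the
  displacement it has at \<open>T'\<close>. The inequality \<open>T < T'\<close> is strict because a
  match compares no values at \<open>T'\<close>.\<close>

lemma J1_match_imp_nhd:
  assumes match: "J1_match e h g 0 T' 0 q" and T: "0 \<le> T" "T < T'" and g: "g \<in> cadlag_space"
  shows "g \<in> J1_nhd h T e"
proof -
  obtain l where l: "strict_mono_on {0..T'} l" "continuous_on {0..T'} l" "l 0 = 0" "l T' = q"
      "\<And>s. s \<in> {0..T'} \<Longrightarrow> \<bar>l s - s\<bar> < e" "\<And>s. s \<in> {0..<T'} \<Longrightarrow> \<bar>g (l s) - h s\<bar> < e"
    using match unfolding J1_match_def by blast
  define k where "k = (\<lambda>s. if s \<le> T' then l s else s + (q - T'))"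
  have k: "k s = l s" if "s \<le> T'" for s using that by (simp add: k_def)
  have k': "k s = s + (q - T')" if "T' \<le> s" for s using that l(4) by (auto simp: k_def)
  have split: "{s \<in> {0..}. s \<le> T'} = {0..T'}" "{s \<in> {0..}. T' \<le> s} = {T'..}" using T by auto
  have mono: "strict_mono_on {0..} k"
    unfolding k_def
    by (rule strict_mono_on_If, unfold split) (use l T in \<open>auto simp: strict_mono_on_def\<close>)
  have "continuous_on ({0..T'} \<union> {T'..}) k"
    unfolding k_def using l by (intro continuous_on_cases continuous_intros) auto
  moreover have "{0..T'} \<union> {T'..} = {0..}" using T by auto
  ultimately have cont: "continuous_on {0..} k" by simp
  have "k ` {0..} = {0..}"
  proof
    show "k ` {0..} \<subseteq> {0..}"
      using strict_mono_onD[OF mono, of 0] k[of 0] l(3) T by (force simp: less_eq_real_def)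
    show "{0..} \<subseteq> k ` {0..}"
    proof
      fix u :: real assume u: "u \<in> {0..}"
      show "u \<in> k ` {0..}"
      proof (cases "u \<le> q")
        case True
        then obtain s where "0 \<le> s" "s \<le> T'" "l s = u"
          using IVT'[of l 0 u T'] l u T by auto
        then show ?thesis using k[of s] by (metis atLeast_iff imageI)
      next
        case False
        then have "k (u - (q - T')) = u" "u - (q - T') \<in> {0..}" using k' T by auto
        then show ?thesis by (metis imageI)
      qed
    qed
  qed
  then have "k \<in> time_changes" using mono cont by (simp add: time_changes_def)
  moreover have "\<bar>k s - s\<bar> < e" if "s \<ge> 0" for s
    using l(5)[of s] l(5)[of T'] l(4) k[of s] k'[of s] that T by (cases "s \<le> T'") auto
  moreover have "\<bar>g (k s) - h s\<bar> < e" if "s \<in> {0..T}" for s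
    using l(6)[of s] k[of s] that T by auto
  ultimately show ?thesis unfolding J1_nhd_def mem_Collect_eq using g
    by (intro conjI bexI[of _ k]) auto
qed

text \<open>
  Near \<open>t\<close> the time change is interpolated linearly between values of \<open>\<sigma> n\<close>; Bolzano's bisection
  principle glues finitely many such pieces.
\<close>

lemma eventually_J1_nhdI:
  assumes h: "h \<in> cadlag_space" and H: "\<And>n. H n \<in> cadlag_space"
    and \<sigma>0: "\<And>n. \<sigma> n 0 = 0" and \<sigma>_nonneg: "\<And>n t. t \<ge> 0 \<Longrightarrow> \<sigma> n t \<ge> 0"
    and \<sigma>: "\<And>t. t \<ge> 0 \<Longrightarrow> (\<lambda>n. \<sigma> n t) \<longlonglongrightarrow> t"
    and close: "\<And>t. t \<ge> 0 \<Longrightarrow> locally_close H (\<lambda>n. \<sigma> n t) h t"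
    and e: "e > 0" and T: "T \<ge> 0"
  shows "\<forall>\<^sub>F n in sequentially. H n \<in> J1_nhd h T e"
proof -
  \<comment> \<open>Bisection also tests intervals that start left of 0, where
    \<open>\<sigma>\<close> is not controlled; the guard makes \<open>Q\<close> vacuous
    there.\<close>
  define Q where "Q x y \<longleftrightarrow> (0 \<le> x \<longrightarrow>
      (\<forall>\<^sub>F n in sequentially. J1_match e h (H n) x y (\<sigma> n x) (\<sigma> n y)))" for x y
  have near: "\<forall>\<^sub>F n in sequentially. \<bar>\<sigma> n t - t\<bar> < \<eta>" if "t \<ge> 0" "\<eta> > 0" for t \<eta>
    using tendstoD[OF \<sigma>[OF that(1)] that(2)] by (simp add: dist_real_def)
  have trans: "Q x z" if "Q x y" "Q y z" "x \<le> y" "y \<le> z" for x y z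
  proof (unfold Q_def, rule impI)
    assume "0 \<le> x"
    then have "\<forall>\<^sub>F n in sequentially. J1_match e h (H n) x y (\<sigma> n x) (\<sigma> n y)"
      "\<forall>\<^sub>F n in sequentially. J1_match e h (H n) y z (\<sigma> n y) (\<sigma> n z)"
      using that by (auto simp: Q_def)
    then show "\<forall>\<^sub>F n in sequentially. J1_match e h (H n) x z (\<sigma> n x) (\<sigma> n z)"
      by eventually_elim (use J1_match_trans that in blast)
  qed
  have refl: "Q x x" for x
    unfolding Q_def using near[of x e] e by (auto elim!: eventually_mono intro: J1_match_refl)
  \<comment> \<open>The extra unit provides the strictly longer interval required by
    \<open>J1_match_imp_nhd\<close>.\<close>
  have "Q 0 (T + 1)"
  proof (rule Bolzano)
    fix t :: real assume t: "0 \<le> t" "t \<le> T + 1"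
    have e2: "e / 2 > 0" using e by simp
    obtain d1 where d1: "d1 > 0" "\<And>s. t \<le> s \<Longrightarrow> s < t + d1 \<Longrightarrow> \<bar>h s - h t\<bar> < e / 2"
      using cadlag_right_nhd[OF h e2] by blast
    obtain d2 where d2: "d2 > 0" "\<And>s. t - d2 < s \<Longrightarrow> s < t \<Longrightarrow> \<bar>h s - left_lim h t\<bar> < e / 2"
      using cadlag_left_nhd[OF h e2] by blast
    obtain d3 where d3: "d3 > 0" "\<forall>\<^sub>F n in sequentially. \<forall>u\<ge>0.
        \<bar>u - t\<bar> < d3 \<longrightarrow> \<bar>H n u - (if u < \<sigma> n t then left_lim h t else h t)\<bar> < e / 2"
      using close[OF t(1)] e2 unfolding locally_close_def by blast
    define d where "d = min (min d1 d2) (d3 / 2)"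
    have d: "d > 0" "d \<le> d1" "d \<le> d2" "d \<le> d3 / 2" using d1 d2 d3 by (auto simp: d_def)
    have right: "Q t y" if y: "t < y" "y < t + d" for y
    proof (unfold Q_def, rule impI)
      \<comment> \<open>The bound \<open>(y - t) / 2\<close> keeps \<open>\<sigma> n t\<close> below
        \<open>\<sigma> n y\<close>, and \<open>d3 / 2\<close> keeps the points between them within
        \<open>d3\<close> of \<open>t\<close>. These points do not precede
        \<open>\<sigma> n t\<close>, so they are compared with \<open>h t\<close>; in the mirror
        case below, points before \<open>\<sigma> n t\<close> are compared with the left
        limit.\<close>
      define \<eta> where "\<eta> = min e (min ((y - t) / 2) (d3 / 2))"
      have \<eta>: "\<eta> \<le> e" "\<eta> \<le> (y - t) / 2" "\<eta> \<le> d3 / 2" unfolding \<eta>_def by linarith+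
      have "\<eta> > 0" using e y d3 by (simp add: \<eta>_def)
      then have "\<forall>\<^sub>F n in sequentially. \<bar>\<sigma> n t - t\<bar> < \<eta>" "\<forall>\<^sub>F n in sequentially. \<bar>\<sigma> n y - y\<bar> < \<eta>"
        using near[of t] near[of y] t y by auto
      with d3(2) show "\<forall>\<^sub>F n in sequentially. J1_match e h (H n) t y (\<sigma> n t) (\<sigma> n y)"
      proof eventually_elim
        case (elim n)
        show ?case
        proof (rule J1_match_linear)
          show "\<sigma> n t < \<sigma> n y" "\<bar>\<sigma> n t - t\<bar> < e" "\<bar>\<sigma> n y - y\<bar> < e"
            using elim(2,3) \<eta> unfolding abs_less_iff by argo+
          fix s u assume s: "s \<in> {t..<y}" and u: "u \<in> {\<sigma> n t..<\<sigma> n y}"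
          have "\<bar>u - t\<bar> < d3" using elim(2,3) u y d(4) \<eta>(3) unfolding atLeastLessThan_iff by linarith
          moreover have "u \<ge> 0" using u \<sigma>_nonneg[OF t(1), of n] by auto
          ultimately have "\<bar>H n u - h t\<bar> < e / 2" using elim(1) u by auto
          moreover have "\<bar>h s - h t\<bar> < e / 2" using d1(2)[of s] s y d by auto
          ultimately show "\<bar>H n u - h s\<bar> < e" by linarith
        qed (use y in auto)
      qed
    qed
    have left: "Q x t" if x: "t - d < x" "x < t" for x
    proof (unfold Q_def, rule impI)
      assume "0 \<le> x"
      define \<eta> where "\<eta> = min e (min ((t - x) / 2) (d3 / 2))"
      have \<eta>: "\<eta> \<le> e" "\<eta> \<le> (t - x) / 2" "\<eta> \<le> d3 / 2" unfolding \<eta>_def by linarith+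
      have "\<eta> > 0" using e x d3 by (simp add: \<eta>_def)
      then have "\<forall>\<^sub>F n in sequentially. \<bar>\<sigma> n t - t\<bar> < \<eta>" "\<forall>\<^sub>F n in sequentially. \<bar>\<sigma> n x - x\<bar> < \<eta>"
        using near[of t] near[of x] t \<open>0 \<le> x\<close> by auto
      with d3(2) show "\<forall>\<^sub>F n in sequentially. J1_match e h (H n) x t (\<sigma> n x) (\<sigma> n t)"
      proof eventually_elim
        case (elim n)
        show ?case
        proof (rule J1_match_linear)
          show "\<sigma> n x < \<sigma> n t" "\<bar>\<sigma> n t - t\<bar> < e" "\<bar>\<sigma> n x - x\<bar> < e"
            using elim(2,3) \<eta> unfolding abs_less_iff by argo+
          fix s u assume s: "s \<in> {x..<t}" and u: "u \<in> {\<sigma> n x..<\<sigma> n t}"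
          have "\<bar>u - t\<bar> < d3" using elim(2,3) u x d(4) \<eta>(3) unfolding atLeastLessThan_iff by linarith
          moreover have "u \<ge> 0" using u \<sigma>_nonneg[OF \<open>0 \<le> x\<close>, of n] by auto
          ultimately have "\<bar>H n u - left_lim h t\<bar> < e / 2" using elim(1) u by auto
          moreover have "\<bar>h s - left_lim h t\<bar> < e / 2" using d2(2)[of s] s x d by auto
          ultimately show "\<bar>H n u - h s\<bar> < e" by linarith
        qed (use x in auto)
      qed
    qed
    show "\<exists>d>0. \<forall>a b. a \<le> t \<and> t \<le> b \<and> b - a < d \<longrightarrow> Q a b"
    proof (intro exI[of _ d] conjI allI impI)
      fix x y assume xy: "x \<le> t \<and> t \<le> y \<and> y - x < d"
      have "Q x t" using left[of x] refl[of t] xy by (cases "x = t") auto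
      moreover have "Q t y" using right[of y] refl[of t] xy by (cases "y = t") auto
      ultimately show "Q x y" using trans xy by blast
    qed (rule d)
  qed (use T trans in auto)
  then have "\<forall>\<^sub>F n in sequentially. J1_match e h (H n) 0 (T + 1) 0 (\<sigma> n (T + 1))"
    by (simp add: Q_def \<sigma>0)
  then show ?thesis
    by (rule eventually_mono) (rule J1_match_imp_nhd[OF _ T _ H], auto)
qed

section \<open>Sufficiency\<close>

lemma time_changes_0:
  assumes "l \<in> time_changes" shows "l 0 = 0"
proof -
  have im: "l ` {0..} = {0..}" and mono: "strict_mono_on {0..} l"
    using assms by (auto simp: time_changes_def)
  obtain s where s: "s \<ge> 0" "l s = 0" using im by (metis atLeast_iff imageE order_refl)
  have "l 0 \<ge> 0" using im by auto
  then show ?thesis using strict_mono_onD[OF mono, of 0 s] s by (cases "s = 0") auto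
qed

lemma time_changes_nonneg: "l \<in> time_changes \<Longrightarrow> s \<ge> 0 \<Longrightarrow> l s \<ge> 0"
  by (auto simp: time_changes_def)

text \<open>Dominated convergence. At almost every \<open>z\<close> the function \<open>f\<close> is
  continuous and differs from \<open>a\<close>; closeness with tolerance
  \<open>\<bar>f z - a\<bar>\<close> puts \<open>F n z\<close> on the same side of \<open>a\<close>
  as \<open>f z\<close>, so the indicators eventually agree.\<close>

lemma time_above_tendsto:
  assumes f: "f \<in> cadlag_space" and F: "\<And>n. F n \<in> cadlag_space"
    and close: "\<And>t. t \<ge> 0 \<Longrightarrow> locally_close F (\<sigma> t) f t"
    and null: "emeasure lborel {t \<in> {0..}. f t = a} = 0"
  shows "(\<lambda>n. time_above a (F n) x) \<longlonglongrightarrow> time_above a f x"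
  unfolding time_above_def set_lebesgue_integral_def
proof (rule integral_dominated_convergence)
  note [measurable] = cadlag_measurable[OF f] cadlag_measurable[OF F]
  have [measurable]: "{z. a < f z} \<in> sets borel" "{z. a < F n z} \<in> sets borel" for n by measurable
  show "integrable lborel (indicator {0..x} :: real \<Rightarrow> real)"
    by (rule integrable_real_indicator) (auto intro: emeasure_lborel_cbox_finite[of 0 x, simplified] simp: emeasure_lborel_Icc_eq)
  show "(\<lambda>z. indicat_real {0..x} z *\<^sub>R indicat_real {z. a < f z} z) \<in> borel_measurable lborel"
    by (intro borel_measurable_scaleR borel_measurable_indicator) simp_all
  show "(\<lambda>z. indicat_real {0..x} z *\<^sub>R indicat_real {z. a < F n z} z) \<in> borel_measurable lborel" for n
    by (intro borel_measurable_scaleR borel_measurable_indicator) simp_all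
  show "AE z in lborel. norm (indicat_real {0..x} z *\<^sub>R indicat_real {z. a < F n z} z) \<le> indicator {0..x} z" for n
    by (auto simp: indicator_def)
  have "{t \<in> {0..}. f t = a} \<in> null_sets lborel"
    using null by (intro null_setsI) auto
  then have "AE z in lborel. z \<notin> {t \<in> {0..}. f t = a}" by (rule AE_not_in)
  moreover have "AE z in lborel. z \<notin> {t. left_lim f t \<noteq> f t}"
    by (intro AE_not_in countable_imp_null_set_lborel countable_cadlag_jumps f)
  ultimately show "AE z in lborel. (\<lambda>n. indicat_real {0..x} z *\<^sub>R indicat_real {z. a < F n z} z)
      \<longlonglongrightarrow> indicat_real {0..x} z *\<^sub>R indicat_real {z. a < f z} z"
  proof eventually_elim
    case (elim z)
    show ?case
    proof (cases "z \<in> {0..x}")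
      case True
      then have z: "z \<ge> 0" "f z \<noteq> a" "left_lim f z = f z" using elim by auto
      then have "\<bar>f z - a\<bar> > 0" by simp
      then obtain d where d: "d > 0" "\<forall>\<^sub>F n in sequentially. \<forall>u\<ge>0.
          \<bar>u - z\<bar> < d \<longrightarrow> \<bar>F n u - (if u < \<sigma> z n then left_lim f z else f z)\<bar> < \<bar>f z - a\<bar>"
        using close[OF z(1)] unfolding locally_close_def by blast
      from d(2) have "\<forall>\<^sub>F n in sequentially. \<bar>F n z - f z\<bar> < \<bar>f z - a\<bar>"
        by (rule eventually_mono) (use z d(1) in \<open>auto dest!: spec[of _ z] split: if_splits\<close>)
      then have "\<forall>\<^sub>F n in sequentially. indicat_real {0..x} z *\<^sub>R indicat_real {z. a < F n z} z =
          indicat_real {0..x} z *\<^sub>R indicat_real {z. a < f z} z"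
        by (rule eventually_mono) (auto simp: indicator_def)
      then show ?thesis by (rule tendsto_eventually)
    qed simp
  qed
qed

section \<open>The matching point of a jump and the values visible around it\<close>

context infinite_time_above
begin

text \<open>All of \<open>[Alinv t, Ainv t]\<close> corresponds to the fast-forwarded time
  \<open>t\<close>, so the jump at \<open>t\<close> can be attached to either end. If
  \<open>f\<close> resumes above \<open>a\<close>, values near \<open>a\<close> met inside must
  count as before the jump; if it resumes at \<open>a\<close>, they count as after it.\<close>

definition \<rho> :: "real \<Rightarrow> real" where
  "\<rho> t = (if f (Ainv t) > a then Ainv t else Alinv t)"

lemma rho_nonneg: "t \<ge> 0 \<Longrightarrow> \<rho> t \<ge> 0"
  by (simp add: \<rho>_def inv_nonneg linv_nonneg)

lemma A_rho: "t \<ge> 0 \<Longrightarrow> A (\<rho> t) = t"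
  by (simp add: \<rho>_def)

text \<open>The assumption \<open>f 0 > a\<close> acts through this fact: nothing is skipped at time
  0, so that \<open>\<rho> 0 = 0\<close> and the matching points fix 0.\<close>

lemma inv_0: "Ainv 0 = 0" if "f 0 > a"
proof (rule antisym)
  show "Ainv 0 \<le> 0"
  proof (rule field_le_epsilon)
    fix e :: real assume "e > 0"
    have "A 0 \<noteq> A e"
      using time_above_eqD[OF cadlag, of 0 a e 0] \<open>e > 0\<close> \<open>f 0 > a\<close> by auto
    then have "0 < A e" using time_above_nonneg[of a f e] by simp
    then show "Ainv 0 \<le> 0 + e" using inv_less_iff[of 0 e] \<open>e > 0\<close> by simp
  qed
qed (simp add: inv_nonneg)

lemma linv_0: "Alinv 0 = 0"
  using linv_le_iff[of 0 0] linv_nonneg[of 0] by simp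

lemma rho_0: "f 0 > a \<Longrightarrow> \<rho> 0 = 0"
  by (simp add: \<rho>_def inv_0 linv_0)

lemma left_lim_below_between:
  assumes "t \<ge> 0" "Alinv t < s" "s \<le> Ainv t" shows "left_lim f s \<le> a"
  by (rule left_lim_le[OF cadlag assms(2)]) (use below_between[OF assms(1)] assms in auto)

text \<open>Strictly inside the skipped stretch a value or left limit is either below
  \<open>a\<close>, hence invisible, or equal to \<open>a\<close>. In the second case it agrees with
  the end value on its side of \<open>\<rho> t\<close>, unless both end values exceed
  \<open>a\<close>, and that case is excluded by \<open>gap\<close>.\<close>

lemma rho_values:
  assumes t: "t > 0" and s: "Alinv t \<le> s" "s \<le> Ainv t"
    and gap: "Alinv t < Ainv t \<Longrightarrow> left_lim f (Alinv t) > a \<Longrightarrow> f (Ainv t) > a \<Longrightarrow>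
      (s < Ainv t \<longrightarrow> f s < a) \<and> (Alinv t < s \<longrightarrow> left_lim f s < a)"
  shows "s \<le> \<rho> t \<Longrightarrow> left_lim f s = left_lim f (Alinv t) \<or> left_lim f s < a"
    and "\<rho> t < s \<Longrightarrow> left_lim f s = f (Ainv t) \<or> left_lim f s < a"
    and "s < \<rho> t \<Longrightarrow> f s = left_lim f (Alinv t) \<or> f s < a"
    and "\<rho> t \<le> s \<Longrightarrow> f s = f (Ainv t) \<or> f s < a"
proof -
  have L: "left_lim f (Alinv t) \<ge> a" and V: "f (Ainv t) \<ge> a"
    using left_lim_linv_ge f_inv_ge t by auto
  have 1: "Alinv t < s \<Longrightarrow> left_lim f s \<le> a" and 2: "s < Ainv t \<Longrightarrow> f s \<le> a"
    using left_lim_below_between[of t s] below_between[of t s] t s by auto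
  show "s \<le> \<rho> t \<Longrightarrow> left_lim f s = left_lim f (Alinv t) \<or> left_lim f s < a"
    using L V 1 2 gap s unfolding \<rho>_def by (cases "s = Alinv t") (force split: if_splits)+
  show "\<rho> t < s \<Longrightarrow> left_lim f s = f (Ainv t) \<or> left_lim f s < a"
    using L V 1 2 gap s unfolding \<rho>_def by (force split: if_splits)
  show "s < \<rho> t \<Longrightarrow> f s = left_lim f (Alinv t) \<or> f s < a"
    using L V 1 2 gap s unfolding \<rho>_def by (force split: if_splits)
  show "\<rho> t \<le> s \<Longrightarrow> f s = f (Ainv t) \<or> f s < a"
    using L V 1 2 gap s unfolding \<rho>_def by (cases "s = Ainv t") (force split: if_splits)+
qed

end

text \<open>Here \<open>gap\<close> is condition (1) for the stretch skipped at \<open>t\<close>,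
  read pointwise. It covers left limits too, because near \<open>s\<close> the functions
  \<open>F n\<close> may follow the left limit of \<open>f\<close> instead of its value.\<close>

locale J1_approximation = infinite_time_above +
  fixes F :: "nat \<Rightarrow> real \<Rightarrow> real" and l :: "nat \<Rightarrow> real \<Rightarrow> real"
  assumes F_between: "\<And>n. F n \<in> cadlag_between (ereal a) \<infinity>"
    and l: "\<And>n. l n \<in> time_changes"
    and l_lim: "uniform_limit {0..} l (\<lambda>s. s) sequentially"
    and F_lim: "\<And>N::nat. uniform_limit {0..real N} (\<lambda>n s. F n (l n s)) f sequentially"
    and f0: "f 0 > a"
    and null: "emeasure lborel {t \<in> {0..}. f t = a} = 0"
    and gap: "\<And>t s. t > 0 \<Longrightarrow> Alinv t < Ainv t \<Longrightarrow> left_lim f (Alinv t) > a \<Longrightarrow> f (Ainv t) > a \<Longrightarrow>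
      Alinv t \<le> s \<Longrightarrow> s \<le> Ainv t \<Longrightarrow>
      (s < Ainv t \<longrightarrow> f s < a) \<and> (Alinv t < s \<longrightarrow> left_lim f s < a)"
begin

sublocale F: infinite_time_above a "F n" for n
  by unfold_locales (rule F_between)

lemma F_close: "t \<ge> 0 \<Longrightarrow> locally_close F (\<lambda>n. l n t) f t"
  by (rule locally_close_time_changes[OF cadlag l l_lim F_lim])

lemma l_tendsto: "t \<ge> 0 \<Longrightarrow> (\<lambda>n. l n t) \<longlonglongrightarrow> t"
  using tendsto_uniform_limitI[OF l_lim, of t] by simp

lemma A_tendsto: "(\<lambda>n. time_above a (F n) x) \<longlonglongrightarrow> A x"
  by (rule time_above_tendsto[OF cadlag F.cadlag F_close null])

text \<open>Near \<open>s\<close> the functions \<open>F n\<close> switch at \<open>l n s\<close>,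
  whereas the switch wanted is at \<open>l n (\<rho> t)\<close>. Where the two prescriptions differ,
  the limit of \<open>f\<close> concerned is below \<open>a\<close>, and
  \<open>F n w \<ge> a\<close> rules it out.\<close>

lemma close_at_point:
  assumes t: "t > 0" and s: "Alinv t \<le> s" "s \<le> Ainv t" and e: "e > 0"
  shows "\<exists>d>0. \<forall>\<^sub>F n in sequentially. \<forall>w\<ge>0. \<bar>w - s\<bar> < d \<longrightarrow> F n w \<ge> a \<longrightarrow>
    \<bar>F n w - (if w < l n (\<rho> t) then left_lim f (Alinv t) else f (Ainv t))\<bar> < e"
proof -
  note vals = rho_values[OF t s gap[OF t _ _ _ s]]
  have s0: "s \<ge> 0" using s(1) linv_nonneg[of t] by linarith
  \<comment> \<open>Small enough that closeness to a one-sided limit below \<open>a\<close> would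
    force \<open>F n w < a\<close>.\<close>
  define e' where "e' = min e (min (if left_lim f s < a then a - left_lim f s else e)
    (if f s < a then a - f s else e))"
  have e': "e' > 0" "e' \<le> e" "left_lim f s < a \<Longrightarrow> e' \<le> a - left_lim f s" "f s < a \<Longrightarrow> e' \<le> a - f s"
    using e by (auto simp: e'_def)
  obtain d1 where d1: "d1 > 0" "\<forall>\<^sub>F n in sequentially. \<forall>w\<ge>0.
      \<bar>w - s\<bar> < d1 \<longrightarrow> \<bar>F n w - (if w < l n s then left_lim f s else f s)\<bar> < e'"
    using F_close[OF s0] e'(1) unfolding locally_close_def by blast
  \<comment> \<open>Within this radius \<open>w\<close> and \<open>l n (\<rho> t)\<close> are
    eventually ordered as \<open>s\<close> and \<open>\<rho> t\<close> are, if these differ.\<close>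
  define d where "d = (if s = \<rho> t then d1 else min d1 (\<bar>\<rho> t - s\<bar> / 2))"
  have d: "d > 0" "d \<le> d1" "s \<noteq> \<rho> t \<Longrightarrow> d \<le> \<bar>\<rho> t - s\<bar> / 2"
    using d1 by (auto simp: d_def simp del: le_divide_eq_numeral1)
  have "\<forall>\<^sub>F n in sequentially. \<bar>l n (\<rho> t) - \<rho> t\<bar> < \<bar>\<rho> t - s\<bar> / 2 \<or> s = \<rho> t"
    using tendstoD[OF l_tendsto[OF rho_nonneg], of t "\<bar>\<rho> t - s\<bar> / 2"] t
    by (cases "s = \<rho> t") (auto simp: dist_real_def)
  with d1(2) have "\<forall>\<^sub>F n in sequentially. \<forall>w\<ge>0. \<bar>w - s\<bar> < d \<longrightarrow> F n w \<ge> a \<longrightarrow>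
    \<bar>F n w - (if w < l n (\<rho> t) then left_lim f (Alinv t) else f (Ainv t))\<bar> < e"
  proof eventually_elim
    case (elim n)
    show ?case
    proof (intro allI impI)
      fix w :: real assume w: "0 \<le> w" "\<bar>w - s\<bar> < d" "a \<le> F n w"
      have Fw: "\<bar>F n w - (if w < l n s then left_lim f s else f s)\<bar> < e'"
        using elim(1) w d(2) by auto
      have left: "\<not> left_lim f s < a" if "w < l n s" using Fw that w(3) e'(3) by auto
      have right: "\<not> f s < a" if "\<not> w < l n s" using Fw that w(3) e'(4) by auto
      consider "s = \<rho> t" | "s < \<rho> t" "w < l n (\<rho> t)" | "s > \<rho> t" "\<not> w < l n (\<rho> t)"
      proof (cases "s = \<rho> t")
        case False
        then have "\<bar>l n (\<rho> t) - \<rho> t\<bar> < \<bar>\<rho> t - s\<bar> / 2" "\<bar>w - s\<bar> < \<bar>\<rho> t - s\<bar> / 2"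
          using elim(2) d(3) w(2) by auto
        with that(2,3) False show ?thesis by (cases "s < \<rho> t") (auto simp: abs_if split: if_splits)
      qed (rule that(1))
      then have "(if w < l n s then left_lim f s else f s) =
          (if w < l n (\<rho> t) then left_lim f (Alinv t) else f (Ainv t))"
        using vals left right by cases auto
      then show "\<bar>F n w - (if w < l n (\<rho> t) then left_lim f (Alinv t) else f (Ainv t))\<bar> < e"
        using Fw e'(2) by linarith
    qed
  qed
  with d(1) show ?thesis by blast
qed

text \<open>Bisection glues the estimates at the points of the skipped stretch. The margin
  \<open>\<eta>\<close> is taken at both ends because the inverse for \<open>F n\<close> at times
  near \<open>t\<close> is only known to lie close to the stretch.\<close>

lemma close_on_interval:
  assumes t: "t > 0" and e: "e > 0"
  shows "\<exists>\<eta>>0. \<forall>\<^sub>F n in sequentially. \<forall>w\<ge>0. Alinv t - \<eta> \<le> w \<longrightarrow> w \<le> Ainv t + \<eta> \<longrightarrow> F n w \<ge> a \<longrightarrow>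
    \<bar>F n w - (if w < l n (\<rho> t) then left_lim f (Alinv t) else f (Ainv t))\<bar> < e"
proof -
  define P where "P x y \<longleftrightarrow> (\<forall>\<^sub>F n in sequentially. \<forall>w\<ge>0. x \<le> w \<longrightarrow> w \<le> y \<longrightarrow> F n w \<ge> a \<longrightarrow>
    \<bar>F n w - (if w < l n (\<rho> t) then left_lim f (Alinv t) else f (Ainv t))\<bar> < e)" for x y
  have trans: "P x z" if "P x y" "P y z" for x y z
    using that unfolding P_def by eventually_elim (meson linear)
  have local: "\<exists>d>0. \<forall>x y. x \<le> s \<and> s \<le> y \<and> y - x < d \<longrightarrow> P x y"
    if s: "Alinv t \<le> s" "s \<le> Ainv t" for s
  proof -
    obtain d where d: "d > 0" "\<forall>\<^sub>F n in sequentially. \<forall>w\<ge>0. \<bar>w - s\<bar> < d \<longrightarrow> F n w \<ge> a \<longrightarrow>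
        \<bar>F n w - (if w < l n (\<rho> t) then left_lim f (Alinv t) else f (Ainv t))\<bar> < e"
      using close_at_point[OF t s e] by blast
    have "P x y" if "x \<le> s" "s \<le> y" "y - x < d" for x y
      unfolding P_def using d(2) by (rule eventually_mono) (use that in auto)
    with d(1) show ?thesis by blast
  qed
  have le: "Alinv t \<le> Ainv t" using linv_le_inv t by simp
  have mid: "P (Alinv t) (Ainv t)"
    by (rule Bolzano[OF le trans local])
  obtain d1 where d1: "d1 > 0" "\<And>x y. x \<le> Alinv t \<Longrightarrow> Alinv t \<le> y \<Longrightarrow> y - x < d1 \<Longrightarrow> P x y"
    using local[OF order_refl le] by blast
  obtain d2 where d2: "d2 > 0" "\<And>x y. x \<le> Ainv t \<Longrightarrow> Ainv t \<le> y \<Longrightarrow> y - x < d2 \<Longrightarrow> P x y"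
    using local[OF le order_refl] by blast
  define \<eta> where "\<eta> = min d1 d2 / 2"
  have \<eta>: "\<eta> > 0" "\<eta> < d1" "\<eta> < d2" using d1(1) d2(1) by (auto simp: \<eta>_def)
  have "P (Alinv t - \<eta>) (Alinv t)" "P (Ainv t) (Ainv t + \<eta>)"
    using d1(2) d2(2) \<eta> by auto
  then have "P (Alinv t - \<eta>) (Ainv t + \<eta>)" using mid trans by blast
  then show ?thesis unfolding P_def using \<eta>(1) by blast
qed

text \<open>Convergence of the occupation times at the two ends of the enlarged stretch traps the
  inverse \<open>w\<close> of \<open>F n\<close> at \<open>u\<close> inside it, and
  \<open>F n w \<ge> a\<close>. By \<open>inv_less_iff\<close> for \<open>F n\<close>, the switch at
  \<open>l n (\<rho> t)\<close> becomes a switch at its occupation time.\<close>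

lemma fast_forward_close:
  assumes t: "t \<ge> 0"
  shows "locally_close (\<lambda>n. left_fast_forward a (F n)) (\<lambda>n. time_above a (F n) (l n (\<rho> t))) ff t"
  unfolding locally_close_def
proof (intro allI impI)
  fix e :: real assume e: "e > 0"
  have "\<exists>\<eta>>0. \<forall>\<^sub>F n in sequentially. \<forall>w\<ge>0. Alinv t - \<eta> \<le> w \<longrightarrow> w \<le> Ainv t + \<eta> \<longrightarrow> F n w \<ge> a \<longrightarrow>
    \<bar>F n w - (if w < l n (\<rho> t) then left_lim ff t else ff t)\<bar> < e"
  proof (cases "t = 0")
    \<comment> \<open>Here the stretch is the single point 0, and \<open>l n 0 = 0\<close> leaves no
      \<open>w \<ge> 0\<close> before the switch, so only the value \<open>f 0\<close> is
      compared.\<close>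
    case True
    obtain d where d: "d > 0" "\<forall>\<^sub>F n in sequentially. \<forall>w\<ge>0.
        \<bar>w - 0\<bar> < d \<longrightarrow> \<bar>F n w - (if w < l n 0 then left_lim f 0 else f 0)\<bar> < e"
      using F_close[of 0] e unfolding locally_close_def by blast
    from d(2) have "\<forall>\<^sub>F n in sequentially. \<forall>w\<ge>0. Alinv t - d / 2 \<le> w \<longrightarrow> w \<le> Ainv t + d / 2 \<longrightarrow> F n w \<ge> a \<longrightarrow>
      \<bar>F n w - (if w < l n (\<rho> t) then left_lim ff t else ff t)\<bar> < e"
      by (rule eventually_mono)
        (use True f0 d(1) in \<open>auto simp: inv_0 linv_0 rho_0 ff_eq time_changes_0[OF l] not_less\<close>)
    then show ?thesis using d(1) by (intro exI[of _ "d / 2"]) auto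
  next
    case False
    then have "t > 0" using t by simp
    then show ?thesis using close_on_interval[OF _ e] by (simp only: left_lim_ff ff_eq[OF t])
  qed
  then obtain \<eta> where \<eta>: "\<eta> > 0" "\<forall>\<^sub>F n in sequentially. \<forall>w\<ge>0.
      Alinv t - \<eta> \<le> w \<longrightarrow> w \<le> Ainv t + \<eta> \<longrightarrow> F n w \<ge> a \<longrightarrow>
      \<bar>F n w - (if w < l n (\<rho> t) then left_lim ff t else ff t)\<bar> < e"
    by blast
  define p where "p = Alinv t - \<eta>"
  define q where "q = Ainv t + \<eta>"
  have q: "q \<ge> 0" "t < A q"
    using inv_less_iff[of t q] inv_nonneg[OF t] t \<eta>(1) by (auto simp: q_def)
  \<comment> \<open>Half distances leave room for the strict inequalities to survive the passage to
    large \<open>n\<close>. For \<open>p < 0\<close> the lower bound on \<open>w\<close> is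
    automatic.\<close>
  define d where "d = min ((A q - t) / 2) (if p \<ge> 0 then (t - A p) / 2 else 1)"
  have p: "A p < t" if "p \<ge> 0" using linv_le_iff[OF that, of t] \<eta>(1) by (auto simp: p_def)
  have d: "d > 0" "d \<le> (A q - t) / 2" "p \<ge> 0 \<Longrightarrow> d \<le> (t - A p) / 2"
    using p q by (auto simp: d_def simp del: le_divide_eq_numeral1)
  have "\<forall>\<^sub>F n in sequentially. t + d < time_above a (F n) q"
    using order_tendstoD(1)[OF A_tendsto, of "t + d" q] d q by simp
  moreover have "\<forall>\<^sub>F n in sequentially. p \<ge> 0 \<longrightarrow> time_above a (F n) p < t - d"
    using order_tendstoD(2)[OF A_tendsto, of p "t - d"] d p by (cases "p \<ge> 0") auto
  ultimately have "\<forall>\<^sub>F n in sequentially. \<forall>u\<ge>0. \<bar>u - t\<bar> < d \<longrightarrow> \<bar>left_fast_forward a (F n) u -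
      (if u < time_above a (F n) (l n (\<rho> t)) then left_lim ff t else ff t)\<bar> < e"
    using \<eta>(2)
  proof eventually_elim
    case (elim n)
    show ?case
    proof (intro allI impI)
      fix u :: real assume u: "0 \<le> u" "\<bar>u - t\<bar> < d"
      define w where "w = time_above_inv a (F n) u"
      have w0: "w \<ge> 0" using F.inv_nonneg[OF u(1)] by (simp add: w_def)
      have "w < q" unfolding w_def using F.inv_less_iff[OF u(1) q(1)] elim(1) u by auto
      moreover have "p \<le> w"
        using F.inv_less_iff[OF u(1), of p n] elim(2) u w0 by (cases "p \<ge> 0") (auto simp: w_def not_less[symmetric])
      moreover have "F n w \<ge> a" using F.f_inv_ge[OF u(1)] by (simp add: w_def)
      ultimately have "\<bar>F n w - (if w < l n (\<rho> t) then left_lim ff t else ff t)\<bar> < e"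
        using elim(3) w0 by (simp only: p_def q_def)
      moreover have "w < l n (\<rho> t) \<longleftrightarrow> u < time_above a (F n) (l n (\<rho> t))"
        unfolding w_def by (rule F.inv_less_iff[OF u(1) time_changes_nonneg[OF l rho_nonneg[OF t]]])
      moreover have "left_fast_forward a (F n) u = F n w" using F.ff_eq[OF u(1)] by (simp add: w_def)
      ultimately show "\<bar>left_fast_forward a (F n) u -
          (if u < time_above a (F n) (l n (\<rho> t)) then left_lim ff t else ff t)\<bar> < e"
        by simp
    qed
  qed
  with d(1) show "\<exists>d>0. \<forall>\<^sub>F n in sequentially. \<forall>u\<ge>0. \<bar>u - t\<bar> < d \<longrightarrow> \<bar>left_fast_forward a (F n) u -
      (if u < time_above a (F n) (l n (\<rho> t)) then left_lim ff t else ff t)\<bar> < e" by blast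
qed

text \<open>The local criterion is applied at the occupation times of \<open>l n (\<rho> t)\<close>.
  They converge to \<open>t\<close>: the Lipschitz bound, uniform in \<open>n\<close>, allows
  \<open>l n (\<rho> t)\<close> to be replaced by \<open>\<rho> t\<close>, and
  \<open>A (\<rho> t) = t\<close>.\<close>

lemma fast_forward_eventually_J1_nhd:
  assumes "e > 0" "T \<ge> 0"
  shows "\<forall>\<^sub>F n in sequentially. left_fast_forward a (F n) \<in> J1_nhd ff T e"
proof (rule eventually_J1_nhdI[OF ff_cadlag F.ff_cadlag, where \<sigma> = "\<lambda>n t. time_above a (F n) (l n (\<rho> t))"])
  show "time_above a (F n) (l n (\<rho> 0)) = 0" for n
    using f0 by (simp add: rho_0 time_changes_0[OF l])
  show "(\<lambda>n. time_above a (F n) (l n (\<rho> t))) \<longlonglongrightarrow> t" if t: "t \<ge> 0" for t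
  proof -
    have "(\<lambda>n. time_above a (F n) (l n (\<rho> t)) - time_above a (F n) (\<rho> t)) \<longlonglongrightarrow> 0"
    proof (rule Lim_null_comparison)
      show "\<forall>\<^sub>F n in sequentially. norm (time_above a (F n) (l n (\<rho> t)) - time_above a (F n) (\<rho> t)) \<le>
          \<bar>l n (\<rho> t) - \<rho> t\<bar>"
        using time_above_lipschitz[OF F.cadlag rho_nonneg[OF t] time_changes_nonneg[OF l rho_nonneg[OF t]]]
        by simp
      show "(\<lambda>n. \<bar>l n (\<rho> t) - \<rho> t\<bar>) \<longlonglongrightarrow> 0"
        using tendsto_rabs[OF LIM_zero[OF l_tendsto[OF rho_nonneg[OF t]]]] by simp
    qed
    then show ?thesis using tendsto_add[OF _ A_tendsto[of "\<rho> t"]] A_rho[OF t] by fastforce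
  qed
  show "locally_close (\<lambda>n. left_fast_forward a (F n)) (\<lambda>n. time_above a (F n) (l n (\<rho> t))) ff t"
    if "t \<ge> 0" for t by (rule fast_forward_close[OF that])
qed (use assms time_above_nonneg in auto)

end

text \<open>The form of continuity in which both directions are proved. As \<open>J1_nhd\<close>
  gives neighbourhoods and not open sets, the translation passes through
  \<open>J1_nhd_interior\<close>, on the target side in one direction and on the source side in the
  other.\<close>

lemma fast_forward_continuous_iff:
  assumes f: "f \<in> cadlag_between (ereal a) \<infinity>"
  shows "topcontinuous_at (subtopology J1_topology (cadlag_between (ereal a) \<infinity>)) J1_topology
      (left_fast_forward a) f \<longleftrightarrow>
    (\<forall>T>0. \<forall>e>0. \<exists>S>0. \<exists>d>0. \<forall>g\<in>J1_nhd f S d \<inter> cadlag_between (ereal a) \<infinity>.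
      left_fast_forward a g \<in> J1_nhd (left_fast_forward a f) T e)"
    (is "?L \<longleftrightarrow> ?R")
proof
  let ?B = "cadlag_between (ereal a) \<infinity>"
  have B: "left_fast_forward a g \<in> cadlag_space" "g \<in> cadlag_space" if "g \<in> ?B" for g
    using infinite_time_above.ff_cadlag infinite_time_above.cadlag that
    unfolding infinite_time_above_def by blast+
  {
    assume L: ?L
    show ?R
    proof (intro allI impI)
      fix T e :: real assume "T > 0" "e > 0"
      then obtain V where V: "openin J1_topology V" "left_fast_forward a f \<in> V"
          "V \<subseteq> J1_nhd (left_fast_forward a f) T e"
        using J1_nhd_interior[OF B(1)[OF f]] by blast
      then obtain W where W: "openin (subtopology J1_topology ?B) W" "f \<in> W"
          "\<And>g. g \<in> W \<Longrightarrow> left_fast_forward a g \<in> V"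
        using L unfolding topcontinuous_at_def by meson
      obtain U where U: "openin J1_topology U" "W = U \<inter> ?B"
        using W(1) unfolding openin_subtopology by blast
      obtain S d where "S > 0" "d > 0" "J1_nhd f S d \<subseteq> U"
        using U W(2) unfolding openin_J1_topology by blast
      then show "\<exists>S>0. \<exists>d>0. \<forall>g\<in>J1_nhd f S d \<inter> ?B.
          left_fast_forward a g \<in> J1_nhd (left_fast_forward a f) T e"
        using U(2) V(3) W(3) by (intro exI[of _ S] exI[of _ d]) blast
    qed
  }
  {
    assume R: ?R
    show ?L
      unfolding topcontinuous_at_def
    proof (intro conjI allI impI)
      fix V assume V: "openin J1_topology V \<and> left_fast_forward a f \<in> V"
      then obtain T e where "T > 0" "e > 0" and Te: "J1_nhd (left_fast_forward a f) T e \<subseteq> V"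
        unfolding openin_J1_topology by blast
      obtain S d where Sd: "S > 0" "d > 0" "\<And>g. g \<in> J1_nhd f S d \<inter> ?B \<Longrightarrow>
          left_fast_forward a g \<in> J1_nhd (left_fast_forward a f) T e"
        using R[rule_format, OF \<open>T > 0\<close> \<open>e > 0\<close>] by blast
      obtain U where U: "openin J1_topology U" "f \<in> U" "U \<subseteq> J1_nhd f S d"
        using J1_nhd_interior[OF B(2)[OF f] Sd(1,2)] by blast
      show "\<exists>W. openin (subtopology J1_topology ?B) W \<and> f \<in> W \<and> (\<forall>g\<in>W. left_fast_forward a g \<in> V)"
        using U Sd(3) Te f by (intro exI[of _ "U \<inter> ?B"]) (auto simp: openin_subtopology)
    qed (use f B in auto)
  }
qed

text \<open>By contradiction: failure on the neighbourhoods with parameters \<open>Suc n\<close> and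
  \<open>1 / Suc n\<close> yields a sequence converging to \<open>f\<close> whose images all stay
  outside. It remains to derive \<open>gap\<close> from condition (1).\<close>

lemma fast_forward_continuous:
  assumes f: "f \<in> cadlag_between (ereal a) \<infinity>" and f0: "f 0 > a"
    and gaps: "\<And>\<epsilon> t1 t2 t3 t4. \<epsilon> > 0 \<Longrightarrow> 0 \<le> t1 \<Longrightarrow> t1 < t2 \<Longrightarrow> t2 < t3 \<Longrightarrow> t3 < t4 \<Longrightarrow>
        (\<And>t. t \<in> {t1..<t2} \<union> {t3..<t4} \<Longrightarrow> f t \<ge> a + \<epsilon>) \<Longrightarrow>
        (\<And>t. t \<in> {t2..<t3} \<Longrightarrow> f t \<le> a) \<Longrightarrow> (SUP t\<in>{t2..<t3}. f t) < a"
    and null: "emeasure lborel {t \<in> {0..}. f t = a} = 0"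
    and T: "T > 0" and e: "e > 0"
  shows "\<exists>S>0. \<exists>d>0. \<forall>g\<in>J1_nhd f S d \<inter> cadlag_between (ereal a) \<infinity>.
      left_fast_forward a g \<in> J1_nhd (left_fast_forward a f) T e"
proof (rule ccontr)
  interpret infinite_time_above a f by unfold_locales (rule f)
  let ?B = "cadlag_between (ereal a) \<infinity>"
  assume neg: "\<not> ?thesis"
  have "\<exists>g. g \<in> J1_nhd f (real (Suc n)) (1 / real (Suc n)) \<and> g \<in> ?B \<and>
      left_fast_forward a g \<notin> J1_nhd ff T e" for n
  proof -
    have "real (Suc n) > 0" "1 / real (Suc n) > 0" by simp_all
    then show ?thesis using neg by blast
  qed
  then obtain F where F: "\<And>n. F n \<in> J1_nhd f (real (Suc n)) (1 / real (Suc n))" "\<And>n. F n \<in> ?B"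
      "\<And>n. left_fast_forward a (F n) \<notin> J1_nhd ff T e"
    by metis
  have "limitin J1_topology F f sequentially"
    unfolding limitin_J1_topology_nhd[OF cadlag]
  proof (intro allI impI)
    fix S d :: real assume "S > 0" "d > 0"
    obtain N :: nat where N: "max S (1 / d) \<le> real N" using real_arch_simple by blast
    have "F n \<in> J1_nhd f S d" if "n \<ge> N" for n
    proof -
      have "max S (1 / d) \<le> real (Suc n)" using N that by simp
      then have "S \<le> real (Suc n)" "1 / real (Suc n) \<le> d"
        using \<open>d > 0\<close> by (auto simp: field_simps)
      then show ?thesis using J1_nhd_mono F(1)[of n] by blast
    qed
    then show "\<forall>\<^sub>F n in sequentially. F n \<in> J1_nhd f S d"
      unfolding eventually_sequentially by blast
  qed
  moreover have "F n \<in> cadlag_space" for n using F(2)[of n] by (simp add: cadlag_between_def)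
  ultimately obtain l where l: "\<And>n. l n \<in> time_changes" "uniform_limit {0..} l (\<lambda>s. s) sequentially"
      "\<And>N::nat. uniform_limit {0..real N} (\<lambda>n s. F n (l n s)) f sequentially"
    using limitin_J1_topology[OF cadlag] by blast
  interpret J1_approximation a f F l
  proof unfold_locales
    fix t s assume t: "t > 0" and less: "Alinv t < Ainv t"
      and L: "left_lim f (Alinv t) > a" and V: "f (Ainv t) > a"
      and s: "Alinv t \<le> s" "s \<le> Ainv t"
    \<comment> \<open>Half of the smaller excess: values within \<open>\<epsilon>\<close> of either
      end value are still at least \<open>a + \<epsilon>\<close>.\<close>
    define \<epsilon> where "\<epsilon> = min (left_lim f (Alinv t) - a) (f (Ainv t) - a) / 2"
    have \<epsilon>: "\<epsilon> > 0" "\<epsilon> \<le> (left_lim f (Alinv t) - a) / 2" "\<epsilon> \<le> (f (Ainv t) - a) / 2"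
      using L V by (auto simp: \<epsilon>_def intro: divide_right_mono)
    obtain d1 where d1: "d1 > 0" "\<And>x. Alinv t - d1 < x \<Longrightarrow> x < Alinv t \<Longrightarrow> \<bar>f x - left_lim f (Alinv t)\<bar> < \<epsilon>"
      using cadlag_left_nhd[OF cadlag \<epsilon>(1)] by blast
    obtain d2 where d2: "d2 > 0" "\<And>x. Ainv t \<le> x \<Longrightarrow> x < Ainv t + d2 \<Longrightarrow> \<bar>f x - f (Ainv t)\<bar> < \<epsilon>"
      using cadlag_right_nhd[OF cadlag \<epsilon>(1)] by blast
    \<comment> \<open>Halving \<open>d1\<close> puts the closed left end inside the open
      neighbourhood; the \<open>max\<close> keeps \<open>t1\<close> in the time domain.\<close>
    define t1 where "t1 = max 0 (Alinv t - d1 / 2)"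
    have sup: "(SUP x\<in>{Alinv t..<Ainv t}. f x) < a"
    proof (rule gaps[OF \<epsilon>(1), of t1 _ _ "Ainv t + d2"])
      show "t1 < Alinv t" using linv_pos[OF t] d1(1) by (simp add: t1_def)
      show "a + \<epsilon> \<le> f x" if "x \<in> {t1..<Alinv t} \<union> {Ainv t..<Ainv t + d2}" for x
        using that
      proof
        assume x: "x \<in> {t1..<Alinv t}"
        then have "\<bar>f x - left_lim f (Alinv t)\<bar> < \<epsilon>" using d1 by (intro d1(2)) (auto simp: t1_def)
        then show ?thesis using \<epsilon>(2) unfolding abs_less_iff by (simp add: field_simps)
      next
        assume "x \<in> {Ainv t..<Ainv t + d2}"
        then have "\<bar>f x - f (Ainv t)\<bar> < \<epsilon>" by (intro d2(2)) auto
        then show ?thesis using \<epsilon>(3) unfolding abs_less_iff by (simp add: field_simps)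
      qed
      show "f x \<le> a" if "x \<in> {Alinv t..<Ainv t}" for x
        using below_between[OF less_imp_le[OF t]] that by simp
    qed (use less d2(1) in \<open>auto simp: t1_def\<close>)
    have bdd: "bdd_above (f ` {Alinv t..<Ainv t})"
      by (rule bdd_aboveI2[of _ _ a]) (use below_between[OF less_imp_le[OF t]] in auto)
    have le: "f x \<le> (SUP x\<in>{Alinv t..<Ainv t}. f x)" if "x \<in> {Alinv t..<Ainv t}" for x
      by (rule cSUP_upper[OF that bdd])
    show "(s < Ainv t \<longrightarrow> f s < a) \<and> (Alinv t < s \<longrightarrow> left_lim f s < a)"
    proof (intro conjI impI)
      show "f s < a" if "s < Ainv t" using le[of s] s that sup by auto
      \<comment> \<open>The supremum is what matters here: \<open>f < a\<close> pointwise would give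
        only \<open>left_lim f s \<le> a\<close>.\<close>
      assume "Alinv t < s"
      then have "left_lim f s \<le> (SUP x\<in>{Alinv t..<Ainv t}. f x)"
        by (rule left_lim_le[OF cadlag]) (use le s in auto)
      then show "left_lim f s < a" using sup by simp
    qed
  qed (rule F(2) l f0 null)+
  show False
    using fast_forward_eventually_J1_nhd[OF e, of T] T F(3)
    by (auto simp: eventually_False)
qed

section \<open>Necessity\<close>

text \<open>The perturbations below are built from steps. With \<open>u \<ge> 0\<close> the dummy
  values at negative arguments stay intact.\<close>

lemma cadlag_add_step:
  assumes f: "f \<in> cadlag_space" and u: "u \<ge> 0"
  shows "(\<lambda>s. f s + (if u \<le> s then c else 0)) \<in> cadlag_space"
proof -
  have right: "((\<lambda>s. if u \<le> s then c else 0) \<longlongrightarrow> (if u \<le> t then c else 0)) (at_right t)" for t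
  proof (rule tendsto_eventually)
    show "\<forall>\<^sub>F s in at_right t. (if u \<le> s then c else 0) = (if u \<le> t then c else 0)"
    proof (cases "u \<le> t")
      case True
      show ?thesis using eventually_at_right_less[of t] by (rule eventually_mono) (use True in auto)
    next
      case False
      then have "t < u" by simp
      show ?thesis using eventually_at_right_real[OF \<open>t < u\<close>] by (rule eventually_mono) auto
    qed
  qed
  have left: "((\<lambda>s. if u \<le> s then c else 0) \<longlongrightarrow> (if u < t then c else 0)) (at_left t)" for t
  proof (rule tendsto_eventually)
    show "\<forall>\<^sub>F s in at_left t. (if u \<le> s then c else 0) = (if u < t then c else 0)"
    proof (cases "u < t")
      case True
      show ?thesis using eventually_at_left_real[OF True] by (rule eventually_mono) auto
    next
      case False
      have "t - 1 < t" by simp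
      then have "\<forall>\<^sub>F s in at_left t. s \<in> {t - 1<..<t}" by (rule eventually_at_left_real)
      then show ?thesis by (rule eventually_mono) (use False in auto)
    qed
  qed
  have "(\<lambda>s. f s + (if u \<le> s then c else 0)) \<in> extensional {0..}"
    using u cadlag_undefined[OF f] by (auto simp: extensional_def)
  moreover note tendsto_add[OF cadlag_tendsto_right[OF f] right]
  moreover note tendsto_add[OF cadlag_tendsto_left[OF f] left]
  ultimately show ?thesis
    unfolding cadlag_space_def mem_Collect_eq by (intro conjI allI impI exI) assumption+
qed

lemma cadlag_between_mono:
  assumes f: "f \<in> cadlag_between (ereal a) \<infinity>" and g: "g \<in> cadlag_space"
    and le: "\<And>s. s \<ge> 0 \<Longrightarrow> f s \<le> g s"
  shows "g \<in> cadlag_between (ereal a) \<infinity>"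
proof -
  note [measurable] = cadlag_measurable[OF g]
  have "\<infinity> = emeasure lborel {t \<in> {0..}. ereal a < ereal (f t) \<and> ereal (f t) < \<infinity>}"
    using f by (simp add: cadlag_between_def)
  also have "\<dots> \<le> emeasure lborel {t \<in> {0..}. ereal a < ereal (g t) \<and> ereal (g t) < \<infinity>}"
  proof (rule emeasure_mono)
    show "{t \<in> {0..}. ereal a < ereal (f t) \<and> ereal (f t) < \<infinity>} \<subseteq>
        {t \<in> {0..}. ereal a < ereal (g t) \<and> ereal (g t) < \<infinity>}"
      using le by (auto dest: less_le_trans)
  qed measurable
  finally show ?thesis using g by (simp add: cadlag_between_def top_unique)
qed

lemma J1_nhd_uniform:
  assumes "g \<in> cadlag_space" "\<And>s. s \<ge> 0 \<Longrightarrow> \<bar>g s - f s\<bar> < d" "d > 0"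
  shows "g \<in> J1_nhd f S d"
  unfolding J1_nhd_def mem_Collect_eq
  using assms by (intro conjI bexI[OF _ id_time_changes]) simp_all

text \<open>A small lift inside the excursion makes a value of at most
  \<open>a + \<epsilon> / 2\<close> visible at the time \<open>A t2\<close>, while close to that
  time \<open>ff\<close> takes only values of at least \<open>a + \<epsilon>\<close>.\<close>

lemma fast_forward_discontinuous_gap:
  assumes f: "f \<in> cadlag_between (ereal a) \<infinity>"
    and t: "\<epsilon> > 0" "0 \<le> t1" "t1 < t2" "t2 < t3" "t3 < t4"
    and above: "\<And>t. t \<in> {t1..<t2} \<union> {t3..<t4} \<Longrightarrow> f t \<ge> a + \<epsilon>"
    and below: "\<And>t. t \<in> {t2..<t3} \<Longrightarrow> f t \<le> a"
    and sup: "\<not> (SUP t\<in>{t2..<t3}. f t) < a"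
    and cont: "\<And>T e. T > 0 \<Longrightarrow> e > 0 \<Longrightarrow> \<exists>S>0. \<exists>d>0. \<forall>g\<in>J1_nhd f S d \<inter> cadlag_between (ereal a) \<infinity>.
      left_fast_forward a g \<in> J1_nhd (left_fast_forward a f) T e"
  shows False
proof -
  interpret infinite_time_above a f by unfold_locales (rule f)
  \<comment> \<open>The time bounds keep every \<open>s\<close> within \<open>e\<close> of
    \<open>A t2\<close> inside the images of the two high stretches; \<open>\<epsilon> / 2\<close>
    separates the values.\<close>
  define e where "e = min (\<epsilon> / 2) (min (t2 - t1) (t4 - t3))"
  have e: "e > 0" "e \<le> \<epsilon> / 2" "e \<le> t2 - t1" "e \<le> t4 - t3" using t by (auto simp: e_def simp del: le_divide_eq_numeral1)
  define T where "T = A t2 + 1 + e"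
  have "T > 0" using time_above_nonneg[of a f t2] e by (simp add: T_def)
  then obtain S d where "S > 0" "d > 0" and Sd: "\<And>g. g \<in> J1_nhd f S d \<Longrightarrow>
      g \<in> cadlag_between (ereal a) \<infinity> \<Longrightarrow> left_fast_forward a g \<in> J1_nhd ff T e"
    using cont[OF _ e(1), of T] by blast
  \<comment> \<open>\<open>c < d\<close> keeps the lifted function in the neighbourhood, and
    \<open>c \<le> \<epsilon> / 2\<close> keeps the lifted value at least
    \<open>\<epsilon> / 2\<close> below both high stretches.\<close>
  define c where "c = min (d / 2) (\<epsilon> / 2)"
  have c: "c > 0" "c < d" "c \<le> \<epsilon> / 2" using \<open>d > 0\<close> t(1) by (auto simp: c_def simp del: le_divide_eq_numeral1)
  have "\<exists>t'\<in>{t2..<t3}. a - c < f t'"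
  proof (rule ccontr)
    assume "\<not> ?thesis"
    then have "(SUP t\<in>{t2..<t3}. f t) \<le> a - c" using t by (intro cSUP_least) (auto simp: not_less)
    then show False using sup c(1) by simp
  qed
  then obtain t' where t': "t2 \<le> t'" "t' < t3" "a - c < f t'" by auto
  then have pos: "f t' - (a - c) > 0" by simp
  obtain \<eta> where \<eta>: "\<eta> > 0" "\<And>s. t' \<le> s \<Longrightarrow> s < t' + \<eta> \<Longrightarrow> \<bar>f s - f t'\<bar> < f t' - (a - c)"
    using cadlag_right_nhd[OF cadlag pos, of t'] by blast
  \<comment> \<open>A bump of height \<open>c\<close> on \<open>[t', t' + \<eta>)\<close>, written
    as the difference of two steps. It only raises \<open>f\<close>, which keeps the time above
    \<open>a\<close> infinite.\<close>
  define g where "g = (\<lambda>s. (f s + (if t' \<le> s then c else 0)) + (if t' + \<eta> \<le> s then - c else 0))"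
  have g_cadlag: "g \<in> cadlag_space"
    unfolding g_def using t t' \<eta>(1) by (intro cadlag_add_step cadlag) auto
  have g_between: "g \<in> cadlag_between (ereal a) \<infinity>"
    by (rule cadlag_between_mono[OF f g_cadlag]) (use \<eta>(1) c in \<open>auto simp: g_def\<close>)
  interpret g: infinite_time_above a g by unfold_locales (rule g_between)
  have "g \<in> J1_nhd f S d"
    by (rule J1_nhd_uniform[OF g_cadlag _ \<open>d > 0\<close>]) (use \<eta>(1) c in \<open>auto simp: g_def\<close>)
  then have "g.ff \<in> J1_nhd ff T e" using Sd g_between by blast
  then obtain l where l: "l \<in> time_changes" "\<And>s. s \<ge> 0 \<Longrightarrow> \<bar>l s - s\<bar> < e"
      "\<And>s. s \<in> {0..T} \<Longrightarrow> \<bar>g.ff (l s) - ff s\<bar> < e"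
    unfolding J1_nhd_def by auto
  define u where "u = A t2"
  have u0: "u \<ge> 0" by (simp add: u_def time_above_nonneg)
  have At': "A t' = u"
    unfolding u_def by (rule time_above_diff_below[OF cadlag]) (use t t' below in auto)
  have gA: "g.A t' = u"
  proof -
    have "{0<..<t'} \<inter> {z. a < g z} = {0<..<t'} \<inter> {z. a < f z}"
      using \<eta>(1) by (auto simp: g_def)
    then show ?thesis
      using At' time_above_diff[OF cadlag, of 0 t' a] time_above_diff[OF g_cadlag, of 0 t' a] t t' by simp
  qed
  \<comment> \<open>Before \<open>t'\<close> nothing has changed, so \<open>g\<close> has the
    occupation time \<open>u\<close> there. Since \<open>g t' > a\<close>, this time grows at once
    after \<open>t'\<close>, and the inverse at \<open>u\<close> is exactly
    \<open>t'\<close>.\<close>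
  have ginv: "g.Ainv u = t'"
  proof (rule antisym)
    show "t' \<le> g.Ainv u"
      using g.inv_less_iff[OF u0, of t'] gA t t' by simp
    show "g.Ainv u \<le> t'"
    proof (rule field_le_epsilon)
      fix r :: real assume "r > 0"
      have "g t' > a" using t'(3) \<eta>(1) by (simp add: g_def)
      then have "g.A t' \<noteq> g.A (t' + r)"
        using time_above_eqD[OF g_cadlag, of t' a "t' + r" t'] \<open>r > 0\<close> t t' by auto
      then have "u < g.A (t' + r)"
        using time_above_mono[OF g_cadlag, of t' "t' + r" a] \<open>r > 0\<close> gA t t' by simp
      then show "g.Ainv u \<le> t' + r"
        using g.inv_less_iff[OF u0, of "t' + r"] \<open>r > 0\<close> t t' by simp
    qed
  qed
  then have gff: "g.ff u = f t' + c" using g.ff_eq[OF u0] \<eta>(1) by (simp add: g_def)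
  have ft': "f t' \<le> a" using below t' by auto
  obtain s where s: "s \<ge> 0" "l s = u" using l(1) u0
    unfolding time_changes_def by (metis (mono_tags, lifting) atLeast_iff imageE mem_Collect_eq)
  have su: "\<bar>s - u\<bar> < e" using l(2)[OF s(1)] s(2) by simp
  have above': "a < f z" if "z \<in> {t1..<t2} \<union> {t3..<t4}" for z
    using above[OF that] t(1) by simp
  have A1: "A t1 = u - (t2 - t1)"
    using time_above_diff_above[OF cadlag, of t1 t2 a] above' t by (simp add: u_def)
  have A3: "A t3 = u"
    unfolding u_def by (rule time_above_diff_below[OF cadlag]) (use t below in auto)
  have A4: "A t4 = u + (t4 - t3)"
    using time_above_diff_above[OF cadlag, of t3 t4 a] above' t A3 by simp
  \<comment> \<open>At \<open>u\<close> the inverse of \<open>A\<close> jumps over the excursion, so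
    nearby times land in the high stretch before it or in the one after it.\<close>
  have "Ainv s \<in> {t1..<t2} \<union> {t3..<t4}"
  proof (cases "s < u")
    case True
    then show ?thesis
      using inv_less_iff[OF s(1), of t1] inv_less_iff[OF s(1), of t2] A1 su e t by (auto simp: u_def)
  next
    case False
    then show ?thesis
      using inv_less_iff[OF s(1), of t3] inv_less_iff[OF s(1), of t4] A3 A4 su e t by auto
  qed
  then have "ff s \<ge> a + \<epsilon>" using above ff_eq[OF s(1)] by simp
  moreover have "s \<in> {0..T}" using s su by (auto simp: T_def u_def)
  then have "\<bar>g.ff u - ff s\<bar> < e" using l(3)[of s] s by simp
  ultimately show False using gff ft' c(3) e(2) by linarith
qed

section \<open>Change of variables for the fast-forwarded function\<close>

context infinite_time_above
begin

lemma Ainv_measurable: "Ainv \<in> borel_measurable (restrict_space lborel {0..<T})"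
proof -
  have "Ainv \<in> borel_measurable (restrict_space borel {0..<T})"
  proof (rule borel_measurable_mono_on_fnc)
    show "mono_on {0..<T} Ainv"
    proof (rule mono_onI)
      fix r s assume "r \<in> {0..<T}" "s \<in> {0..<T}" "r \<le> s"
      then show "Ainv r \<le> Ainv s" using inv_strict_mono[of r s] by (cases "r = s") auto
    qed
  qed
  then show ?thesis by (simp cong: measurable_cong_sets add: sets_restrict_space)
qed

text \<open>The image of Lebesgue measure under \<open>Ainv\<close> is Lebesgue measure restricted
  to \<open>{f > a}\<close>. Both are finite measures on the line, so it suffices to compare them on
  the half-lines \<open>{x<..}\<close>.\<close>

lemma emeasure_Ainv:
  assumes T: "T \<ge> 0" and S: "S \<in> sets borel"
  shows "emeasure lborel {u \<in> {0..<A T}. Ainv u \<in> S} =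
    emeasure lborel ({0..<T} \<inter> {z. a < f z} \<inter> S)"
proof -
  have fm [measurable]: "f \<in> borel_measurable borel" by (rule cadlag_measurable[OF cadlag])
  have B: "{0..<T} \<inter> {z. a < f z} \<in> sets borel" by measurable
  define M where "M = distr (restrict_space lborel {0..<A T}) borel Ainv"
  define N where "N = density lborel (indicator ({0..<T} \<inter> {z. a < f z}))"
  have eM: "emeasure M X = emeasure lborel {u \<in> {0..<A T}. Ainv u \<in> X}" if "X \<in> sets borel" for X
  proof -
    have "emeasure M X = emeasure (restrict_space lborel {0..<A T}) (Ainv -` X \<inter> {0..<A T})"
      unfolding M_def using emeasure_distr[OF Ainv_measurable[of "A T"] that] by (simp add: space_restrict_space)
    also have "\<dots> = emeasure lborel (Ainv -` X \<inter> {0..<A T})"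
      by (rule emeasure_restrict_space) auto
    also have "Ainv -` X \<inter> {0..<A T} = {u \<in> {0..<A T}. Ainv u \<in> X}" by auto
    finally show ?thesis .
  qed
  have eN: "emeasure N X = emeasure lborel ({0..<T} \<inter> {z. a < f z} \<inter> X)" if "X \<in> sets borel" for X
    unfolding N_def using that B
    by (subst emeasure_density) (auto simp flip: indicator_inter_arith nn_integral_indicator)
  have "M = N"
  proof (rule measure_eqI_lessThan)
    show "sets M = sets borel" "sets N = sets borel" by (simp_all add: M_def N_def)
    fix x :: real
    have meas: "{u \<in> {0..<A T}. x < Ainv u} \<in> sets lborel"
    proof -
      have "Ainv -` {x<..} \<inter> space (restrict_space lborel {0..<A T}) \<in> sets (restrict_space lborel {0..<A T})"
        by (rule measurable_sets[OF Ainv_measurable]) simp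
      then have "Ainv -` {x<..} \<inter> {0..<A T} \<in> sets lborel"
        by (auto simp: space_restrict_space sets_restrict_space_iff)
      moreover have "Ainv -` {x<..} \<inter> {0..<A T} = {u \<in> {0..<A T}. x < Ainv u}" by auto
      ultimately show ?thesis by simp
    qed
    \<comment> \<open>With \<open>x\<close> clamped to \<open>[0, T]\<close>, the condition
      \<open>Ainv u > x\<close> becomes \<open>u \<ge> A y\<close>, except possibly at the null
      point \<open>u = A y\<close>, where \<open>Ainv u\<close> may equal \<open>y\<close>.\<close>
    define y where "y = max 0 (min x T)"
    have y: "0 \<le> y" "y \<le> T" using T by (auto simp: y_def)
    have AyT: "A y \<le> A T" using mono_A y by simp
    have "emeasure lborel {u \<in> {0..<A T}. x < Ainv u} = emeasure lborel {A y..<A T}"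
    proof (rule emeasure_eq_AE)
      show "AE u in lborel. u \<in> {u \<in> {0..<A T}. x < Ainv u} \<longleftrightarrow> u \<in> {A y..<A T}"
        using AE_lborel_singleton[of "A y"]
      proof eventually_elim
        case (elim u)
        show ?case
        proof
          assume u: "u \<in> {u \<in> {0..<A T}. x < Ainv u}"
          have "y \<le> Ainv u" using u inv_nonneg[of u] by (auto simp: y_def)
          then show "u \<in> {A y..<A T}"
            using inv_less_iff[of u y] u y by (simp add: not_less[symmetric])
        next
          assume u: "u \<in> {A y..<A T}"
          then have u0: "u \<ge> 0" using time_above_nonneg[of a f y] by simp
          have "y \<noteq> T" using u by auto
          then have "x \<le> y" using y by (auto simp: y_def max_def min_def split: if_splits)
          moreover have "\<not> Ainv u \<le> y"
            using mono_A[OF inv_nonneg[OF u0], of y] A_inv[OF u0] u elim by auto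
          ultimately show "u \<in> {u \<in> {0..<A T}. x < Ainv u}" using u u0 by simp
        qed
      qed
    qed (use meas in auto)
    also have "\<dots> = ennreal (A T - A y)" using AyT by simp
    also have "A T - A y = measure lborel ({y<..<T} \<inter> {z. a < f z})"
      by (rule time_above_diff[OF cadlag y])
    also have "ennreal \<dots> = emeasure lborel ({y<..<T} \<inter> {z. a < f z})"
      using fmeasurableD2[OF above_fmeasurable[OF cadlag, of "{y<..<T}" a]]
      by (simp add: emeasure_eq_ennreal_measure)
    also have "\<dots> = emeasure lborel ({0..<T} \<inter> {z. a < f z} \<inter> {x<..})"
    proof (rule emeasure_eq_AE)
      show "AE u in lborel. u \<in> {y<..<T} \<inter> {z. a < f z} \<longleftrightarrow> u \<in> {0..<T} \<inter> {z. a < f z} \<inter> {x<..}"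
        using AE_lborel_singleton[of 0] by eventually_elim (auto simp: y_def)
    qed auto
    finally show "emeasure M {x<..} = emeasure N {x<..}"
      using eM[of "{x<..}"] eN[of "{x<..}"] by simp
    have "emeasure lborel {u \<in> {0..<A T}. x < Ainv u} \<le> emeasure lborel {0..<A T}"
      by (rule emeasure_mono) auto
    also have "\<dots> < \<infinity>" using time_above_nonneg[of a f T] by simp
    finally show "emeasure M {x<..} < \<infinity>" using eM[of "{x<..}"] by simp
  qed
  then show ?thesis using eM[OF S] eN[OF S] by simp
qed

lemma emeasure_ff:
  assumes T: "T \<ge> 0" and S: "S \<in> sets borel"
  shows "emeasure lborel {u \<in> {0..<A T}. ff u \<in> S} =
    emeasure lborel ({0..<T} \<inter> {z. a < f z \<and> f z \<in> S})"
proof -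
  have "f -` S \<in> sets borel"
    using measurable_sets[OF cadlag_measurable[OF cadlag] S] by simp
  then have "emeasure lborel {u \<in> {0..<A T}. Ainv u \<in> f -` S} =
      emeasure lborel ({0..<T} \<inter> {z. a < f z} \<inter> f -` S)" by (rule emeasure_Ainv[OF T])
  moreover have "{u \<in> {0..<A T}. Ainv u \<in> f -` S} = {u \<in> {0..<A T}. ff u \<in> S}" by (auto simp: ff_eq)
  moreover have "{0..<T} \<inter> {z. a < f z} \<inter> f -` S = {0..<T} \<inter> {z. a < f z \<and> f z \<in> S}" by auto
  ultimately show ?thesis by simp
qed

text \<open>On \<open>[0, A n)\<close> the times with \<open>ff \<le> a\<close> have the measure of
  \<open>{f > a} \<inter> {f \<le> a}\<close>, which is empty; these intervals exhaust the half-line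
  as \<open>A\<close> is unbounded.\<close>

lemma AE_ff_above: "AE u in lborel. u \<ge> 0 \<longrightarrow> a < ff u"
proof -
  have null: "AE u in lborel. u \<in> {0..<A (real n)} \<longrightarrow> a < ff u" for n
  proof -
    have [measurable]: "ff \<in> borel_measurable borel" by (rule cadlag_measurable[OF ff_cadlag])
    have "{0..<real n} \<inter> {z. a < f z \<and> f z \<in> {..a}} = {}" by auto
    then have "emeasure lborel {u \<in> {0..<A (real n)}. ff u \<in> {..a}} = 0"
      using emeasure_ff[of "real n" "{..a}"] by (simp only: emeasure_empty) simp
    then have "{u \<in> {0..<A (real n)}. ff u \<in> {..a}} \<in> null_sets lborel"
      by (intro null_setsI) auto
    then have "AE u in lborel. u \<notin> {u \<in> {0..<A (real n)}. ff u \<in> {..a}}" by (rule AE_not_in)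
    then show ?thesis by (rule AE_mp) auto
  qed
  then have "AE u in lborel. \<forall>n. u \<in> {0..<A (real n)} \<longrightarrow> a < ff u" by (simp only: AE_all_countable) blast
  then show ?thesis
  proof eventually_elim
    case (elim u)
    obtain s where "s \<ge> 0" "u < A s" using time_above_unbounded by blast
    moreover obtain n :: nat where "s \<le> real n" using real_arch_simple by blast
    ultimately have "u < A (real n)" using mono_A[of s "real n"] by simp
    then show ?case using elim by auto
  qed
qed

end

text \<open>The image of \<open>f + r\<close> spends at least the time \<open>c > 0\<close> in
  \<open>(a, a + r]\<close>. In the limit, a set of measure at least \<open>c\<close> consists of
  times arbitrarily near which \<open>ff\<close> has values at most arbitrarily little above
  \<open>a\<close>. At a continuity point this means \<open>ff \<le> a\<close>, which happens almost
  nowhere.\<close>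

lemma fast_forward_discontinuous_level:
  assumes f: "f \<in> cadlag_between (ereal a) \<infinity>"
    and level: "emeasure lborel {t \<in> {0..}. f t = a} \<noteq> 0"
    and cont: "\<And>T e. T > 0 \<Longrightarrow> e > 0 \<Longrightarrow> \<exists>S>0. \<exists>d>0. \<forall>g\<in>J1_nhd f S d \<inter> cadlag_between (ereal a) \<infinity>.
      left_fast_forward a g \<in> J1_nhd (left_fast_forward a f) T e"
  shows False
proof -
  interpret infinite_time_above a f by unfold_locales (rule f)
  have fm [measurable]: "f \<in> borel_measurable borel" by (rule cadlag_measurable[OF cadlag])
  \<comment> \<open>A bounded piece of the level set keeps all measures finite, as continuity from
    above requires.\<close>
  obtain n :: nat where n: "emeasure lborel ({0..<real n} \<inter> {t. f t = a}) \<noteq> 0"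
  proof (rule ccontr)
    assume "\<not> thesis"
    then have "emeasure lborel ({0..<real n} \<inter> {t. f t = a}) = 0" for n using that by blast
    then have "(\<Union>n. {0..<real n} \<inter> {t. f t = a}) \<in> null_sets lborel"
      by (intro null_sets_UN' null_setsI) auto
    moreover have "(\<Union>n. {0..<real n} \<inter> {t. f t = a}) = {t \<in> {0..}. f t = a}"
      using reals_Archimedean2 by auto
    ultimately show False using level by auto
  qed
  define T where "T = real n"
  define c where "c = emeasure lborel ({0..<T} \<inter> {t. f t = a})"
  have T: "T \<ge> 0" and c: "c > 0" using n by (auto simp: T_def c_def zero_less_iff_neq_zero)
  \<comment> \<open>A time change need not preserve measure, so the tolerance is put into time as
    well as into the value: \<open>U k\<close> collects the times \<open>u\<close> themselves, not
    the points \<open>s\<close> matched with them.\<close>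
  define U where "U k = {u \<in> {0..<T}. \<exists>s. s \<ge> 0 \<and> \<bar>s - u\<bar> < 1 / real (Suc k) \<and> ff s \<le> a + 1 / real (Suc k)}" for k
  have U_meas: "U k \<in> sets lborel" for k
  proof -
    have "U k = {0..<T} \<inter> (\<Union>s\<in>{s. s \<ge> 0 \<and> ff s \<le> a + 1 / real (Suc k)}. ball s (1 / real (Suc k)))"
      by (auto simp: U_def dist_real_def)
    also have "\<dots> \<in> sets lborel" 
      using borel_open[OF open_UN[of _ "\<lambda>s. ball s (1 / real (Suc k))"]] by (intro sets.Int) auto
    finally show ?thesis .
  qed
  have U_large: "c \<le> emeasure lborel (U k)" for k
  proof -
    \<comment> \<open>The lift \<open>r \<le> e\<close> and the error \<open>e\<close> of the
      approximation add up to the tolerance of \<open>U k\<close>.\<close>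
    define e where "e = 1 / real (Suc k) / 2"
    have e: "e > 0" "e \<le> 1" "2 * e = 1 / real (Suc k)" by (simp_all add: e_def field_simps)
    have "T + 1 > 0" using T by simp
    then obtain S d where "S > 0" and d: "d > 0" and Sd: "\<And>g. g \<in> J1_nhd f S d \<Longrightarrow>
        g \<in> cadlag_between (ereal a) \<infinity> \<Longrightarrow> left_fast_forward a g \<in> J1_nhd ff (T + 1) e"
      using cont[OF _ e(1), of "T + 1"] by blast
    define r where "r = min (d / 2) e"
    have r: "r > 0" "r < d" "r \<le> e" using d e by (auto simp: r_def)
    define g where "g = (\<lambda>s. f s + (if 0 \<le> s then r else 0))"
    have g_cadlag: "g \<in> cadlag_space" unfolding g_def by (rule cadlag_add_step[OF cadlag]) simp
    have g_between: "g \<in> cadlag_between (ereal a) \<infinity>"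
      by (rule cadlag_between_mono[OF f g_cadlag]) (use r in \<open>auto simp: g_def\<close>)
    interpret g: infinite_time_above a g by unfold_locales (rule g_between)
    have "g \<in> J1_nhd f S d"
      by (rule J1_nhd_uniform[OF g_cadlag _ d]) (use r in \<open>auto simp: g_def\<close>)
    then have "g.ff \<in> J1_nhd ff (T + 1) e" using Sd g_between by blast
    then obtain l where l: "l \<in> time_changes" "\<And>s. s \<ge> 0 \<Longrightarrow> \<bar>l s - s\<bar> < e"
        "\<And>s. s \<in> {0..T+1} \<Longrightarrow> \<bar>g.ff (l s) - ff s\<bar> < e"
      unfolding J1_nhd_def by auto
    have gAT: "g.A T \<le> T"
      using time_above_le[OF g_cadlag order_refl T, of a] by simp
    note [measurable] = cadlag_measurable[OF g_cadlag]
    have "c \<le> emeasure lborel ({0..<T} \<inter> {z. a < g z \<and> g z \<in> {..a+r}})"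
      unfolding c_def by (rule emeasure_mono) (use r in \<open>auto simp: g_def\<close>)
    also have "\<dots> = emeasure lborel {u \<in> {0..<g.A T}. g.ff u \<in> {..a+r}}"
      by (rule g.emeasure_ff[OF T, symmetric]) simp
    also have "\<dots> \<le> emeasure lborel (U k)"
    proof (rule emeasure_mono[OF _ U_meas], rule subsetI)
      fix u assume u: "u \<in> {u \<in> {0..<g.A T}. g.ff u \<in> {..a+r}}"
      then have "u \<in> {0..}" by simp
      then have "u \<in> l ` {0..}" using l(1) by (simp add: time_changes_def)
      then obtain s where s: "s \<ge> 0" "u = l s" by auto
      have su: "\<bar>u - s\<bar> < e" using l(2)[OF s(1)] s(2) by simp
      moreover have "s \<in> {0..T+1}" using su s u gAT e by auto
      then have "\<bar>g.ff u - ff s\<bar> < e" using l(3) s by simp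
      then have "ff s \<le> a + 2 * e" using u r(3) by auto
      ultimately show "u \<in> U k"
        using s u gAT e unfolding U_def by (auto intro!: exI[of _ s])
    qed
    finally show ?thesis .
  qed
  have "(\<lambda>k. emeasure lborel (U k)) \<longlonglongrightarrow> emeasure lborel (\<Inter>k. U k)"
  proof (rule Lim_emeasure_decseq)
    show "decseq U"
    proof (rule decseq_SucI)
      fix k
      have "1 / real (Suc (Suc k)) \<le> 1 / real (Suc k)" by (simp add: frac_le)
      then show "U (Suc k) \<subseteq> U k" unfolding U_def by (smt (verit) Collect_mono)
    qed
    have "emeasure lborel (U k) \<le> emeasure lborel {0..<T}" for k
      by (rule emeasure_mono) (auto simp: U_def)
    then show "emeasure lborel (U k) \<noteq> \<infinity>" for k
      using T by (metis emeasure_lborel_Ico ennreal_neq_top infinity_ennreal_def top.extremum_uniqueI)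
  qed (use U_meas in auto)
  then have "c \<le> emeasure lborel (\<Inter>k. U k)"
    by (rule LIMSEQ_le_const) (use U_large in auto)
  moreover have "emeasure lborel (\<Inter>k. U k) = 0"
  proof (rule null_setsD1, subst AE_iff_null_sets)
    show "(\<Inter>k. U k) \<in> sets lborel" using U_meas by (intro sets.countable_INT') auto
    have "AE u in lborel. u \<notin> {t. left_lim ff t \<noteq> ff t}"
      by (intro AE_not_in countable_imp_null_set_lborel countable_cadlag_jumps ff_cadlag)
    with AE_ff_above show "AE u in lborel. u \<notin> (\<Inter>k. U k)"
    proof eventually_elim
      case (elim u)
      show ?case
      proof
        assume u: "u \<in> (\<Inter>k. U k)"
        then have u0: "u \<ge> 0" by (auto simp: U_def)
        \<comment> \<open>\<open>a + r\<close> is the midpoint of \<open>a\<close> and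
          \<open>ff u\<close>: continuity at \<open>u\<close> keeps \<open>ff s\<close> above it,
          whereas membership in \<open>U k\<close> with \<open>1 / Suc k < r\<close> puts
          \<open>ff s\<close> below it.\<close>
        define r where "r = (ff u - a) / 2"
        have r: "r > 0" using elim(1) u0 by (simp add: r_def)
        obtain d1 where d1: "d1 > 0" "\<And>s. u \<le> s \<Longrightarrow> s < u + d1 \<Longrightarrow> \<bar>ff s - ff u\<bar> < r"
          using cadlag_right_nhd[OF ff_cadlag r] by blast
        obtain d2 where d2: "d2 > 0" "\<And>s. u - d2 < s \<Longrightarrow> s < u \<Longrightarrow> \<bar>ff s - ff u\<bar> < r"
          using cadlag_left_nhd[OF ff_cadlag r, of u] elim(2) by auto
        have "min r (min d1 d2) > 0" using r d1 d2 by simp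
        then obtain k where k: "1 / real (Suc k) < min r (min d1 d2)"
          using nat_approx_posE by metis
        obtain s where s: "s \<ge> 0" "\<bar>s - u\<bar> < 1 / real (Suc k)" "ff s \<le> a + 1 / real (Suc k)"
          using u by (auto simp: U_def)
        have "\<bar>ff s - ff u\<bar> < r" using d1(2)[of s] d2(2)[of s] s k by (cases "u \<le> s") auto
        moreover have "1 / real (Suc k) < r" using k by (simp only: min_less_iff_conj)
        ultimately show False using s(3) unfolding r_def abs_less_iff by argo
      qed
    qed
  qed
  ultimately show False using c by simp
qed

theorem theorem3p11:
  fixes a :: real and f :: "real \<Rightarrow> real"
  assumes "f \<in> cadlag_between (ereal a) \<infinity>"
    and "f 0 > a"
  shows "topcontinuous_at (subtopology J1_topology (cadlag_between (ereal a) \<infinity>)) J1_topology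
           (left_fast_forward a) f \<longleftrightarrow>
         (\<forall>\<epsilon> t\<^sub>1 t\<^sub>2 t\<^sub>3 t\<^sub>4. \<epsilon> > 0 \<and> 0 \<le> t\<^sub>1 \<and> t\<^sub>1 < t\<^sub>2 \<and> t\<^sub>2 < t\<^sub>3 \<and> t\<^sub>3 < t\<^sub>4 \<and>
            (\<forall>t\<in>{t\<^sub>1..<t\<^sub>2} \<union> {t\<^sub>3..<t\<^sub>4}. f t \<ge> a + \<epsilon>) \<and> (\<forall>t\<in>{t\<^sub>2..<t\<^sub>3}. f t \<le> a) \<longrightarrow>
            (SUP t\<in>{t\<^sub>2..<t\<^sub>3}. f t) < a) \<and>
         emeasure lborel {t \<in> {0..}. f t = a} = 0"
    (is "?cont \<longleftrightarrow> ?gaps \<and> ?null")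
proof (intro iffI conjI)
  assume ?cont
  then have cont: "\<exists>S>0. \<exists>d>0. \<forall>g\<in>J1_nhd f S d \<inter> cadlag_between (ereal a) \<infinity>.
      left_fast_forward a g \<in> J1_nhd (left_fast_forward a f) T e" if "T > 0" "e > 0" for T e
    using fast_forward_continuous_iff[OF assms(1)] that by blast
  show ?gaps
  proof (intro allI impI, elim conjE)
    fix \<epsilon> t1 t2 t3 t4
    assume t: "0 < \<epsilon>" "0 \<le> t1" "t1 < t2" "t2 < t3" "t3 < t4"
      and above: "\<forall>t\<in>{t1..<t2} \<union> {t3..<t4}. a + \<epsilon> \<le> f t" and below: "\<forall>t\<in>{t2..<t3}. f t \<le> a"
    show "(SUP t\<in>{t2..<t3}. f t) < a"
      using fast_forward_discontinuous_gap[OF assms(1) t bspec[OF above] bspec[OF below] _ cont]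
      by blast
  qed
  show ?null
    using fast_forward_discontinuous_level[OF assms(1) _ cont] by blast
next
  assume "?gaps \<and> ?null"
  then have gaps: ?gaps and null: ?null by blast+
  show ?cont
    unfolding fast_forward_continuous_iff[OF assms(1)]
  proof (intro allI impI)
    fix T e :: real assume Te: "T > 0" "e > 0"
    show "\<exists>S>0. \<exists>d>0. \<forall>g\<in>J1_nhd f S d \<inter> cadlag_between (ereal a) \<infinity>.
        left_fast_forward a g \<in> J1_nhd (left_fast_forward a f) T e"
      by (rule fast_forward_continuous[OF assms _ null Te]) (use gaps in blast)
  qed
qed

end
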